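(* Let $X$ be a ULF graph with large circuits. Then $H^{\mathrm{uf}}_1(X,\mathbb{Z}_2)$ is infinite-dimensional as a $\mathbb{Z}_2$-vector space.
   Context: A ULF graph has uniformly bounded degrees; $d$ is the graph metric. For a ULF simplicial complex $Y$, $C^{\mathrm{suf}}_n(Y,\mathbb{Z}_2)$ is the group of $\mathbb{Z}_2$-valued functions on $n$-simplices with the simplicial boundary, and $H^{\mathrm{suf}}_n$ its homology. The Rips complex $R_rX$ has as simplices the finite vertex sets of pairwise distance $\le r$, and $H^{\mathrm{uf}}_n(X,\mathbb{Z}_2)$ is the direct limit over $r$ of $H^{\mathrm{suf}}_n(R_rX,\mathbb{Z}_2)$. A circuit is a closed path $(v_1,\dots,v_s)$ ($v_i\sim v_{i+1}$, indices mod $s$) of length $s$, identified with its edge set in $\mathbb{Z}_2^{EX}$. A family in $\mathbb{Z}_2^{EX}$ is thin if each edge lies in the support of only finitely many members; its sum is then defined pointwise. $\mathcal{C}(X,\mathbb{Z}_2)$ is the set of sums of thin families of circuits and $\mathcal{C}_R(X,\mathbb{Z}_2)$ the set of sums of thin families of circuits of length $\le R$. $X$ has large circuits if there is no $R>0$ such that every circuit is a sum of a thin family of circuits of length $\le R$ (equivalently, $\mathcal{C}(X,\mathbb{Z}_2)\neq\mathcal{C}_R(X,\mathbb{Z}_2)$ for every $R$). *)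

theory Defs
  imports
    "Jordan_Normal_Form.VS_Connect"
    "HOL-Algebra.AbelCoset"
    "HOL-Library.Z2"
    "HOL-Library.Extended_Nat"
begin

section \<open>Quotient modules and sequential direct limits of modules\<close>

text \<open>The ring multiplication and the unit of a module record play no role; they are left
  unspecified.\<close>

definition quot_module :: "('r, 'a) module \<Rightarrow> 'a set \<Rightarrow> ('r, 'a set) module" where
  "quot_module M N =
    \<lparr>carrier = a_rcosets\<^bsub>M\<^esub> N, mult = undefined, one = undefined,
     zero = N, add = set_add M,
     smult = (\<lambda>a A. \<Union>x\<in>A. N +>\<^bsub>M\<^esub> (a \<odot>\<^bsub>M\<^esub> x))\<rparr>"

text \<open>A direct system is given by modules \<^term>\<open>M r\<close> and maps \<^term>\<open>f r s\<close> from \<^term>\<open>M r\<close> to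
  \<^term>\<open>M s\<close> for \<^term>\<open>r \<le> s\<close>. Its limit is the disjoint union of the \<^term>\<open>M r\<close> modulo eventual
  equality; the operations are the usual ones on representatives.\<close>

definition dlim_class ::
  "(nat \<Rightarrow> ('r, 'a) module) \<Rightarrow> (nat \<Rightarrow> nat \<Rightarrow> 'a \<Rightarrow> 'a) \<Rightarrow> nat \<Rightarrow> 'a \<Rightarrow> (nat \<times> 'a) set" where
  "dlim_class M f r x =
    {(s, y). y \<in> carrier (M s) \<and> (\<exists>t. r \<le> t \<and> s \<le> t \<and> f r t x = f s t y)}"

definition direct_limit ::
  "(nat \<Rightarrow> ('r, 'a) module) \<Rightarrow> (nat \<Rightarrow> nat \<Rightarrow> 'a \<Rightarrow> 'a) \<Rightarrow> ('r, (nat \<times> 'a) set) module" where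
  "direct_limit M f =
    \<lparr>carrier = {dlim_class M f r x | r x. x \<in> carrier (M r)}, mult = undefined, one = undefined,
     zero = dlim_class M f 0 \<zero>\<^bsub>M 0\<^esub>,
     add = (\<lambda>A B. \<Union>(r, x)\<in>A. \<Union>(s, y)\<in>B.
       dlim_class M f (max r s) (f r (max r s) x \<oplus>\<^bsub>M (max r s)\<^esub> f s (max r s) y)),
     smult = (\<lambda>a A. \<Union>(r, x)\<in>A. dlim_class M f r (a \<odot>\<^bsub>M r\<^esub> x))\<rparr>"


section \<open>Uniformly finite simplicial homology with coefficients in \<open>\<int>/2\<close>\<close>

text \<open>A simplicial complex is a set \<open>K\<close> of nonempty finite vertex sets closed under nonempty
  subsets; an \<open>n\<close>-simplex is an element with \<open>n + 1\<close> vertices. A chain is an arbitrary (possibly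
  infinitely supported) function on the \<open>n\<close>-simplices, extended by zero. For
  \<open>\<int>/2\<close>-coefficients every function is bounded.\<close>

definition chains :: "'v set set \<Rightarrow> nat \<Rightarrow> ('v set \<Rightarrow> bit) set" where
  "chains K n = {c. \<forall>\<sigma>. c \<sigma> \<noteq> 0 \<longrightarrow> \<sigma> \<in> K \<and> card \<sigma> = Suc n}"

text \<open>The sum is finite when \<open>K\<close> is locally finite. As the empty set is not a simplex, the
  boundary of a 0-chain is zero (no augmentation).\<close>

definition boundary :: "'v set set \<Rightarrow> ('v set \<Rightarrow> bit) \<Rightarrow> 'v set \<Rightarrow> bit" where
  "boundary K c \<sigma> =
    (if \<sigma> \<in> K then \<Sum>\<tau> | \<tau> \<in> K \<and> \<sigma> \<subset> \<tau> \<and> card \<tau> = Suc (card \<sigma>). c \<tau> else 0)"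

definition cycles :: "'v set set \<Rightarrow> nat \<Rightarrow> ('v set \<Rightarrow> bit) set" where
  "cycles K n = {c \<in> chains K n. boundary K c = (\<lambda>_. 0)}"

definition boundaries :: "'v set set \<Rightarrow> nat \<Rightarrow> ('v set \<Rightarrow> bit) set" where
  "boundaries K n = boundary K ` chains K (Suc n)"

definition cycle_module :: "'v set set \<Rightarrow> nat \<Rightarrow> (bit, 'v set \<Rightarrow> bit) module" where
  "cycle_module K n =
    \<lparr>carrier = cycles K n, mult = undefined, one = undefined, zero = (\<lambda>_. 0),
     add = (\<lambda>c d \<sigma>. c \<sigma> + d \<sigma>), smult = (\<lambda>a c \<sigma>. a * c \<sigma>)\<rparr>"

definition H_suf :: "'v set set \<Rightarrow> nat \<Rightarrow> (bit, ('v set \<Rightarrow> bit) set) module" where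
  "H_suf K n = quot_module (cycle_module K n) (boundaries K n)"

text \<open>The map to \<^term>\<open>H_suf L n\<close> induced by the inclusion of a subcomplex in \<open>L\<close>: it sends the
  class of a cycle \<open>z\<close> to the class of \<open>z\<close>.\<close>

definition H_suf_map ::
  "'v set set \<Rightarrow> nat \<Rightarrow> ('v set \<Rightarrow> bit) set \<Rightarrow> ('v set \<Rightarrow> bit) set" where
  "H_suf_map L n A = (\<Union>z\<in>A. boundaries L n +>\<^bsub>cycle_module L n\<^esub> z)"


section \<open>Graphs of uniformly bounded degree\<close>

definition ulf_graph :: "'v set \<Rightarrow> 'v set set \<Rightarrow> bool" where
  "ulf_graph V E \<longleftrightarrow>
    (\<forall>e\<in>E. e \<subseteq> V \<and> card e = 2) \<and>
    (\<exists>D::nat. \<forall>v\<in>V. finite {w. {v, w} \<in> E} \<and> card {w. {v, w} \<in> E} \<le> D)"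

definition walks :: "'v set set \<Rightarrow> 'v \<Rightarrow> 'v \<Rightarrow> 'v list set" where
  "walks E u v = {p. p \<noteq> [] \<and> hd p = u \<and> last p = v \<and>
    (\<forall>i. Suc i < length p \<longrightarrow> {p ! i, p ! Suc i} \<in> E)}"

text \<open>Vertices in different components have distance \<open>\<infinity>\<close>.\<close>

definition graph_dist :: "'v set set \<Rightarrow> 'v \<Rightarrow> 'v \<Rightarrow> enat" where
  "graph_dist E u v = (INF p\<in>walks E u v. enat (length p - 1))"

definition rips :: "'v set \<Rightarrow> 'v set set \<Rightarrow> nat \<Rightarrow> 'v set set" where
  "rips V E r = {\<sigma>. \<sigma> \<noteq> {} \<and> finite \<sigma> \<and> \<sigma> \<subseteq> V \<and> (\<forall>u\<in>\<sigma>. \<forall>v\<in>\<sigma>. graph_dist E u v \<le> enat r)}"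

text \<open>As the graph metric takes values in \<open>\<nat> \<union> {\<infinity>}\<close>, it suffices to take the limit over
  natural scales.\<close>

definition H_uf ::
  "'v set \<Rightarrow> 'v set set \<Rightarrow> nat \<Rightarrow> (bit, (nat \<times> ('v set \<Rightarrow> bit) set) set) module" where
  "H_uf V E n =
    direct_limit (\<lambda>r. H_suf (rips V E r) n) (\<lambda>r s. H_suf_map (rips V E s) n)"


section \<open>Circuits\<close>

definition circuit :: "'v set set \<Rightarrow> 'v list \<Rightarrow> bool" where
  "circuit E c \<longleftrightarrow> c \<noteq> [] \<and> (\<forall>i<length c. {c ! i, c ! (Suc i mod length c)} \<in> E)"

text \<open>The element of \<open>(\<int>/2)\<^bsup>E\<^esup>\<close> given by a circuit: closed paths may repeat
  vertices and edges, and edges are counted modulo 2. If the vertices are distinct and there are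
  at least three of them, this is the indicator function of the edge set
  (\<open>circuit_vec_eq_indicator\<close> below); the degenerate circuit \<open>[u, v]\<close> gives zero.\<close>

definition circuit_vec :: "'v list \<Rightarrow> 'v set \<Rightarrow> bit" where
  "circuit_vec c e = of_nat (card {i. i < length c \<and> {c ! i, c ! (Suc i mod length c)} = e})"

definition thin :: "'v set set \<Rightarrow> 'i set \<Rightarrow> ('i \<Rightarrow> 'v set \<Rightarrow> bit) \<Rightarrow> bool" where
  "thin E I f \<longleftrightarrow> (\<forall>e\<in>E. finite {i \<in> I. f i e \<noteq> 0})"

definition thin_sum :: "'i set \<Rightarrow> ('i \<Rightarrow> 'v set \<Rightarrow> bit) \<Rightarrow> 'v set \<Rightarrow> bit" where
  "thin_sum I f e = (\<Sum>i | i \<in> I \<and> f i e \<noteq> 0. f i e)"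

text \<open>Each edge meets only finitely many members of a thin family, so the nonzero members of a
  thin family can be indexed injectively by pairs of an edge and a natural number, whatever the
  original index set. Hence this index type gives all sums of thin families
  (\<open>thin_sums_arbitrary_index\<close> below).\<close>

definition thin_sums :: "'v set set \<Rightarrow> ('v set \<Rightarrow> bit) set \<Rightarrow> ('v set \<Rightarrow> bit) set" where
  "thin_sums E S = {thin_sum I f | (I :: ('v set \<times> nat) set) f. thin E I f \<and> f ` I \<subseteq> S}"

definition circuit_sums :: "'v set set \<Rightarrow> nat \<Rightarrow> ('v set \<Rightarrow> bit) set" where
  "circuit_sums E R = thin_sums E (circuit_vec ` {c. circuit E c \<and> length c \<le> R})"

definition large_circuits :: "'v set set \<Rightarrow> bool" where
  "large_circuits E \<longleftrightarrow>
    \<not> (\<exists>R>0. \<forall>c. circuit E c \<longrightarrow> circuit_vec c \<in> circuit_sums E R)"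


section \<open>Well-definedness\<close>

lemma submodule_abelian_subgroup:
  assumes M: "Module.module R M" and N: "LinearCombinations.submodule R N M"
  shows "abelian_subgroup N M"
proof -
  interpret M: Module.module R M by (rule M)
  interpret N: LinearCombinations.submodule R N M by (rule N)
  have inv: "\<ominus>\<^bsub>M\<^esub> x \<in> N" if "x \<in> N" for x
  proof -
    have x: "x \<in> carrier M" using that N.subset by blast
    have "(\<ominus>\<^bsub>R\<^esub> \<one>\<^bsub>R\<^esub>) \<odot>\<^bsub>M\<^esub> x \<in> N" using that by simp
    then show ?thesis using x by (simp add: M.smult_l_minus)
  qed
  have sg: "subgroup N (add_monoid M)"
    by (rule M.add.subgroupI) (use N.subset inv N.zero_closed in \<open>auto simp: a_inv_def simp del: N.zero_closed\<close>)
  show ?thesis by (rule abelian_subgroupI2[OF M.a_comm_group sg])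
qed

lemma quot_module_module:
  assumes M: "Module.module R M" and N: "LinearCombinations.submodule R N M"
  shows "Module.module R (quot_module M N)"
proof -
  interpret M: Module.module R M by (rule M)
  interpret N: LinearCombinations.submodule R N M by (rule N)
  interpret S: abelian_subgroup N M by (rule submodule_abelian_subgroup[OF M N])
  note sg = S.a_subgroup
  have add: "(N +>\<^bsub>M\<^esub> x) <+>\<^bsub>M\<^esub> (N +>\<^bsub>M\<^esub> y) = N +>\<^bsub>M\<^esub> (x \<oplus>\<^bsub>M\<^esub> y)"
    if "x \<in> carrier M" "y \<in> carrier M" for x y
    using S.a_rcos_sum[OF that] .
  have sm: "(\<Union>z\<in>N +>\<^bsub>M\<^esub> x. N +>\<^bsub>M\<^esub> (a \<odot>\<^bsub>M\<^esub> z)) = N +>\<^bsub>M\<^esub> (a \<odot>\<^bsub>M\<^esub> x)"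
    if a: "a \<in> carrier R" and x: "x \<in> carrier M" for a x
  proof -
    have "N +>\<^bsub>M\<^esub> (a \<odot>\<^bsub>M\<^esub> z) = N +>\<^bsub>M\<^esub> (a \<odot>\<^bsub>M\<^esub> x)" if z: "z \<in> N +>\<^bsub>M\<^esub> x" for z
    proof -
      obtain n where n: "n \<in> N" "z = n \<oplus>\<^bsub>M\<^esub> x"
        using z by (auto simp: a_r_coset_def' )
      then have "n \<in> carrier M" using N.subset by blast
      then have "a \<odot>\<^bsub>M\<^esub> z = a \<odot>\<^bsub>M\<^esub> n \<oplus>\<^bsub>M\<^esub> a \<odot>\<^bsub>M\<^esub> x"
        using n a x by (simp add: M.smult_r_distr)
      moreover have "a \<odot>\<^bsub>M\<^esub> n \<in> N" using n a by simp
      ultimately have "a \<odot>\<^bsub>M\<^esub> z \<in> N +>\<^bsub>M\<^esub> (a \<odot>\<^bsub>M\<^esub> x)"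
        by (auto simp: a_r_coset_def')
      then show ?thesis
        using M.a_repr_independence[OF _ _ sg] a x by simp
    qed
    moreover have "x \<in> N +>\<^bsub>M\<^esub> x" using S.a_rcos_self x by simp
    ultimately show ?thesis by blast
  qed
  have car: "carrier (quot_module M N) = (\<lambda>x. N +>\<^bsub>M\<^esub> x) ` carrier M"
    by (auto simp: quot_module_def A_RCOSETS_def')
  have qadd: "(N +>\<^bsub>M\<^esub> x) \<oplus>\<^bsub>quot_module M N\<^esub> (N +>\<^bsub>M\<^esub> y) = N +>\<^bsub>M\<^esub> (x \<oplus>\<^bsub>M\<^esub> y)"
    if "x \<in> carrier M" "y \<in> carrier M" for x y
    using add[OF that] by (simp add: quot_module_def)
  have qsm: "a \<odot>\<^bsub>quot_module M N\<^esub> (N +>\<^bsub>M\<^esub> x) = N +>\<^bsub>M\<^esub> (a \<odot>\<^bsub>M\<^esub> x)"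
    if "a \<in> carrier R" "x \<in> carrier M" for a x
    using sm[OF that] by (simp add: quot_module_def)
  have qz: "\<zero>\<^bsub>quot_module M N\<^esub> = N +>\<^bsub>M\<^esub> \<zero>\<^bsub>M\<^esub>"
    using M.a_coset_join2[OF M.zero_closed sg] N.zero_closed by (simp add: quot_module_def)
  have ag: "abelian_group (quot_module M N)"
  proof (rule abelian_groupI)
    fix A assume "A \<in> carrier (quot_module M N)"
    then obtain x where x: "x \<in> carrier M" "A = N +>\<^bsub>M\<^esub> x" by (auto simp: car)
    show "\<exists>B\<in>carrier (quot_module M N). B \<oplus>\<^bsub>quot_module M N\<^esub> A = \<zero>\<^bsub>quot_module M N\<^esub>"
      using x by (intro bexI[of _ "N +>\<^bsub>M\<^esub> (\<ominus>\<^bsub>M\<^esub> x)"]) (auto simp: car qadd qz M.l_neg)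
  next
    fix A B assume "A \<in> carrier (quot_module M N)" "B \<in> carrier (quot_module M N)"
    then show "A \<oplus>\<^bsub>quot_module M N\<^esub> B = B \<oplus>\<^bsub>quot_module M N\<^esub> A"
      by (auto simp: car qadd M.a_comm)
  qed (auto simp: car qadd qz M.a_assoc)
  show ?thesis
    by (rule Module.moduleI[OF M.R.is_cring ag])
      (auto simp: car qadd qsm M.smult_l_distr M.smult_r_distr M.smult_assoc1)
qed

locale direct_system =
  fixes R and M :: "nat \<Rightarrow> ('r, 'a) module" and f
  assumes mod: "Module.module R (M r)"
    and hom: "r \<le> s \<Longrightarrow> f r s \<in> LinearCombinations.module_hom R (M r) (M s)"
    and f_id: "x \<in> carrier (M r) \<Longrightarrow> f r r x = x"
    and f_comp: "r \<le> s \<Longrightarrow> s \<le> t \<Longrightarrow> x \<in> carrier (M r) \<Longrightarrow> f s t (f r s x) = f r t x"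
begin


lemma f_closed: "r \<le> s \<Longrightarrow> x \<in> carrier (M r) \<Longrightarrow> f r s x \<in> carrier (M s)"
  using hom[of r s] by (auto simp: LinearCombinations.module_hom_def)

lemma cl_eq:
  assumes x: "x \<in> carrier (M r)" and y: "y \<in> carrier (M s)"
    and t: "r \<le> t" "s \<le> t" "f r t x = f s t y"
  shows "dlim_class M f r x = dlim_class M f s y"
proof -
  have "dlim_class M f r x \<subseteq> dlim_class M f s y"
    if x: "x \<in> carrier (M r)" and y: "y \<in> carrier (M s)"
      and t: "r \<le> t" "s \<le> t" "f r t x = f s t y" for r s x y
  proof
    fix p assume "p \<in> dlim_class M f r x"
    then obtain q z u where p: "p = (q, z)" "z \<in> carrier (M q)" "r \<le> u" "q \<le> u"
      "f r u x = f q u z" by (auto simp: dlim_class_def)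
    define w where "w = max t u"
    have "f s w y = f t w (f s t y)" using f_comp[of s t w y] t y by (simp add: w_def)
    also have "\<dots> = f r w x" using f_comp[of r t w x] t x by (simp add: w_def)
    also have "\<dots> = f u w (f r u x)" using f_comp[of r u w x] p x by (simp add: w_def)
    also have "\<dots> = f q w z" using f_comp[of q u w z] p by (simp add: w_def)
    finally show "p \<in> dlim_class M f s y"
      unfolding dlim_class_def using p t by (auto simp: w_def intro!: exI[of _ w])
  qed
  from this[OF x y t] this[OF y x t(2,1) t(3)[symmetric]] show ?thesis by blast
qed

lemma cl_self: "x \<in> carrier (M r) \<Longrightarrow> (r, x) \<in> dlim_class M f r x"
  by (auto simp: dlim_class_def)

lemma cl_up: "r \<le> t \<Longrightarrow> x \<in> carrier (M r) \<Longrightarrow> dlim_class M f t (f r t x) = dlim_class M f r x"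
  by (rule cl_eq[of _ _ _ _ t]) (auto simp: f_closed f_id)

lemma cl_add:
  assumes x: "x \<in> carrier (M t)" and y: "y \<in> carrier (M t)"
  shows "dlim_class M f t x \<oplus>\<^bsub>direct_limit M f\<^esub> dlim_class M f t y = dlim_class M f t (x \<oplus>\<^bsub>M t\<^esub> y)"
proof -
  interpret T: Module.module R "M t" by (rule mod)
  have *: "dlim_class M f (max r s) (f r (max r s) u \<oplus>\<^bsub>M (max r s)\<^esub> f s (max r s) v)
      = dlim_class M f t (x \<oplus>\<^bsub>M t\<^esub> y)"
    if u: "(r, u) \<in> dlim_class M f t x" and v: "(s, v) \<in> dlim_class M f t y" for r s u v
  proof -
    obtain p where p: "u \<in> carrier (M r)" "t \<le> p" "r \<le> p" "f t p x = f r p u"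
      using u by (auto simp: dlim_class_def)
    obtain q where q: "v \<in> carrier (M s)" "t \<le> q" "s \<le> q" "f t q y = f s q v"
      using v by (auto simp: dlim_class_def)
    define w where "w = max p q"
    define m where "m = max r s"
    interpret Mm: Module.module R "M m" by (rule mod)
    have le: "r \<le> m" "s \<le> m" "m \<le> w" "t \<le> w" "p \<le> w" "q \<le> w" "r \<le> w" "s \<le> w"
      using p q by (auto simp: w_def m_def)
    have 1: "f r w u = f t w x"
      using f_comp[of r p w u] f_comp[of t p w x] p le x by simp
    have 2: "f s w v = f t w y"
      using f_comp[of s q w v] f_comp[of t q w y] q le y by simp
    have c: "f r m u \<in> carrier (M m)" "f s m v \<in> carrier (M m)"
      using f_closed le p q by auto
    have "f m w (f r m u \<oplus>\<^bsub>M m\<^esub> f s m v) = f m w (f r m u) \<oplus>\<^bsub>M w\<^esub> f m w (f s m v)"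
      using hom[OF le(3)] c by (simp add: LinearCombinations.module_hom_def)
    also have "\<dots> = f t w x \<oplus>\<^bsub>M w\<^esub> f t w y"
      using f_comp le p q 1 2 by simp
    also have "\<dots> = f t w (x \<oplus>\<^bsub>M t\<^esub> y)"
      using hom[OF le(4)] x y by (simp add: LinearCombinations.module_hom_def)
    finally have e: "f m w (f r m u \<oplus>\<^bsub>M m\<^esub> f s m v) = f t w (x \<oplus>\<^bsub>M t\<^esub> y)" .
    show ?thesis
      unfolding m_def[symmetric] using e le x y c by (intro cl_eq[of _ _ _ _ w]) auto
  qed
  have "(\<Union>(r, u)\<in>dlim_class M f t x. \<Union>(s, v)\<in>dlim_class M f t y.
       dlim_class M f (max r s) (f r (max r s) u \<oplus>\<^bsub>M (max r s)\<^esub> f s (max r s) v))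
    = dlim_class M f t (x \<oplus>\<^bsub>M t\<^esub> y)" (is "?L = _")
  proof
    show "?L \<subseteq> dlim_class M f t (x \<oplus>\<^bsub>M t\<^esub> y)" using * by fast
    show "dlim_class M f t (x \<oplus>\<^bsub>M t\<^esub> y) \<subseteq> ?L"
      using *[OF cl_self[OF x] cl_self[OF y]] cl_self[OF x] cl_self[OF y] by fast
  qed
  then show ?thesis by (simp add: direct_limit_def)
qed

lemma cl_smult:
  assumes a: "a \<in> carrier R" and x: "x \<in> carrier (M t)"
  shows "a \<odot>\<^bsub>direct_limit M f\<^esub> dlim_class M f t x = dlim_class M f t (a \<odot>\<^bsub>M t\<^esub> x)"
proof -
  have *: "dlim_class M f r (a \<odot>\<^bsub>M r\<^esub> u) = dlim_class M f t (a \<odot>\<^bsub>M t\<^esub> x)"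
    if u: "(r, u) \<in> dlim_class M f t x" for r u
  proof -
    obtain p where p: "u \<in> carrier (M r)" "t \<le> p" "r \<le> p" "f t p x = f r p u"
      using u by (auto simp: dlim_class_def)
    have "f r p (a \<odot>\<^bsub>M r\<^esub> u) = f t p (a \<odot>\<^bsub>M t\<^esub> x)"
      using hom[OF p(2)] hom[OF p(3)] p a x by (simp add: LinearCombinations.module_hom_def)
    then show ?thesis
      using p a x Module.module.smult_closed[OF mod] by (intro cl_eq[of _ _ _ _ p]) auto
  qed
  have "(\<Union>(r, u)\<in>dlim_class M f t x. dlim_class M f r (a \<odot>\<^bsub>M r\<^esub> u)) = dlim_class M f t (a \<odot>\<^bsub>M t\<^esub> x)"
    (is "?L = _")
  proof
    show "?L \<subseteq> dlim_class M f t (a \<odot>\<^bsub>M t\<^esub> x)" using * by fast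
    show "dlim_class M f t (a \<odot>\<^bsub>M t\<^esub> x) \<subseteq> ?L"
      using *[OF cl_self[OF x]] cl_self[OF x] by fast
  qed
  then show ?thesis by (simp add: direct_limit_def)
qed

lemma cl_zero: "\<zero>\<^bsub>direct_limit M f\<^esub> = dlim_class M f t \<zero>\<^bsub>M t\<^esub>"
proof -
  interpret Z: Module.module R "M 0" by (rule mod)
  interpret T: Module.module R "M t" by (rule mod)
  have "f 0 t \<zero>\<^bsub>M 0\<^esub> = f 0 t (\<zero>\<^bsub>R\<^esub> \<odot>\<^bsub>M 0\<^esub> \<zero>\<^bsub>M 0\<^esub>)" by simp
  also have "\<dots> = \<zero>\<^bsub>R\<^esub> \<odot>\<^bsub>M t\<^esub> f 0 t \<zero>\<^bsub>M 0\<^esub>"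
    by (rule LinearCombinations.module_hom_smult[OF hom]) auto
  also have "\<dots> = \<zero>\<^bsub>M t\<^esub>" using f_closed[of 0 t] by simp
  finally show ?thesis
    using cl_up[of 0 t "\<zero>\<^bsub>M 0\<^esub>"] by (simp add: direct_limit_def)
qed

lemma cl_carrier: "x \<in> carrier (M t) \<Longrightarrow> dlim_class M f t x \<in> carrier (direct_limit M f)"
  by (auto simp: direct_limit_def)

lemma common3:
  assumes "A \<in> carrier (direct_limit M f)" "B \<in> carrier (direct_limit M f)"
    "C \<in> carrier (direct_limit M f)"
  obtains t x y z where "x \<in> carrier (M t)" "y \<in> carrier (M t)" "z \<in> carrier (M t)"
    "A = dlim_class M f t x" "B = dlim_class M f t y" "C = dlim_class M f t z"
proof -
  obtain r x s y q z where c: "x \<in> carrier (M r)" "y \<in> carrier (M s)" "z \<in> carrier (M q)"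
    "A = dlim_class M f r x" "B = dlim_class M f s y" "C = dlim_class M f q z"
    using assms by (auto simp: direct_limit_def)
  define t where "t = max r (max s q)"
  have "r \<le> t" "s \<le> t" "q \<le> t" by (auto simp: t_def)
  then show ?thesis
    using c f_closed cl_up by (intro that[of "f r t x" t "f s t y" "f q t z"]) auto
qed

lemma direct_limit_module: "Module.module R (direct_limit M f)"
proof -
  interpret Z: Module.module R "M 0" by (rule mod)
  let ?L = "direct_limit M f"
  have ag: "abelian_group ?L"
  proof (rule abelian_groupI)
    fix A B assume "A \<in> carrier ?L" "B \<in> carrier ?L"
    then obtain t x y where t: "x \<in> carrier (M t)" "y \<in> carrier (M t)"
      "A = dlim_class M f t x" "B = dlim_class M f t y" by (metis common3)
    interpret T: Module.module R "M t" by (rule mod)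
    show "A \<oplus>\<^bsub>?L\<^esub> B \<in> carrier ?L" using t by (simp add: cl_add cl_carrier)
    show "A \<oplus>\<^bsub>?L\<^esub> B = B \<oplus>\<^bsub>?L\<^esub> A" using t by (simp add: cl_add T.a_comm)
  next
    show "\<zero>\<^bsub>?L\<^esub> \<in> carrier ?L" using cl_zero[of 0] cl_carrier by simp
  next
    fix A B C assume "A \<in> carrier ?L" "B \<in> carrier ?L" "C \<in> carrier ?L"
    then obtain t x y z where t: "x \<in> carrier (M t)" "y \<in> carrier (M t)" "z \<in> carrier (M t)"
      "A = dlim_class M f t x" "B = dlim_class M f t y" "C = dlim_class M f t z"
      by (metis common3)
    interpret T: Module.module R "M t" by (rule mod)
    show "(A \<oplus>\<^bsub>?L\<^esub> B) \<oplus>\<^bsub>?L\<^esub> C = A \<oplus>\<^bsub>?L\<^esub> (B \<oplus>\<^bsub>?L\<^esub> C)"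
      using t by (simp add: cl_add T.a_assoc)
  next
    fix A assume "A \<in> carrier ?L"
    then obtain t x where t: "x \<in> carrier (M t)" "A = dlim_class M f t x" by (metis common3)
    interpret T: Module.module R "M t" by (rule mod)
    show "\<zero>\<^bsub>?L\<^esub> \<oplus>\<^bsub>?L\<^esub> A = A" using t by (simp add: cl_zero[of t] cl_add)
    show "\<exists>B\<in>carrier ?L. B \<oplus>\<^bsub>?L\<^esub> A = \<zero>\<^bsub>?L\<^esub>"
      using t by (intro bexI[of _ "dlim_class M f t (\<ominus>\<^bsub>M t\<^esub> x)"])
        (auto simp: cl_zero[of t] cl_add cl_carrier T.l_neg)
  qed
  show ?thesis
  proof (rule Module.moduleI[OF Z.R.is_cring ag])
    fix a A assume a: "a \<in> carrier R" and A: "A \<in> carrier ?L"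
    then obtain t x where t: "x \<in> carrier (M t)" "A = dlim_class M f t x" by (metis common3)
    interpret T: Module.module R "M t" by (rule mod)
    show "a \<odot>\<^bsub>?L\<^esub> A \<in> carrier ?L" using t a by (simp add: cl_smult cl_carrier)
  next
    fix A assume A: "A \<in> carrier ?L"
    then obtain t x where t: "x \<in> carrier (M t)" "A = dlim_class M f t x" by (metis common3)
    interpret T: Module.module R "M t" by (rule mod)
    show "\<one>\<^bsub>R\<^esub> \<odot>\<^bsub>?L\<^esub> A = A" using t by (simp add: cl_smult)
  next
    fix a b A assume a: "a \<in> carrier R" "b \<in> carrier R" and A: "A \<in> carrier ?L"
    then obtain t x where t: "x \<in> carrier (M t)" "A = dlim_class M f t x" by (metis common3)
    interpret T: Module.module R "M t" by (rule mod)
    show "(a \<oplus>\<^bsub>R\<^esub> b) \<odot>\<^bsub>?L\<^esub> A = a \<odot>\<^bsub>?L\<^esub> A \<oplus>\<^bsub>?L\<^esub> b \<odot>\<^bsub>?L\<^esub> A"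
      using t a by (simp add: cl_smult cl_add T.smult_l_distr)
    show "(a \<otimes>\<^bsub>R\<^esub> b) \<odot>\<^bsub>?L\<^esub> A = a \<odot>\<^bsub>?L\<^esub> (b \<odot>\<^bsub>?L\<^esub> A)"
      using t a by (simp add: cl_smult T.smult_assoc1)
  next
    fix a A B assume a: "a \<in> carrier R" and A: "A \<in> carrier ?L" "B \<in> carrier ?L"
    then obtain t x y where t: "x \<in> carrier (M t)" "y \<in> carrier (M t)"
      "A = dlim_class M f t x" "B = dlim_class M f t y" by (metis common3)
    interpret T: Module.module R "M t" by (rule mod)
    show "a \<odot>\<^bsub>?L\<^esub> (A \<oplus>\<^bsub>?L\<^esub> B) = a \<odot>\<^bsub>?L\<^esub> A \<oplus>\<^bsub>?L\<^esub> a \<odot>\<^bsub>?L\<^esub> B"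
      using t a by (simp add: cl_smult cl_add T.smult_r_distr)
  qed
qed

end



definition locally_finite_complex :: "'v set set \<Rightarrow> bool" where
  "locally_finite_complex K \<longleftrightarrow> {} \<notin> K \<and> (\<forall>\<sigma>\<in>K. finite \<sigma>) \<and>
    (\<forall>\<sigma>\<in>K. \<forall>\<rho>. \<rho> \<subseteq> \<sigma> \<and> \<rho> \<noteq> {} \<longrightarrow> \<rho> \<in> K) \<and> (\<forall>\<sigma>\<in>K. finite {\<tau>\<in>K. \<sigma> \<subseteq> \<tau>})"

lemma face_closed: "locally_finite_complex K \<Longrightarrow> \<sigma> \<in> K \<Longrightarrow> \<rho> \<subseteq> \<sigma> \<Longrightarrow> \<rho> \<noteq> {} \<Longrightarrow> \<rho> \<in> K"
  unfolding locally_finite_complex_def by blast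

lemma finite_cofaces:
  assumes "locally_finite_complex K" "\<sigma> \<in> K"
  shows "finite {\<tau>. \<tau> \<in> K \<and> \<sigma> \<subset> \<tau> \<and> P \<tau>}"
  by (rule finite_subset[of _ "{\<tau>\<in>K. \<sigma> \<subseteq> \<tau>}"])
    (use assms in \<open>auto simp: locally_finite_complex_def\<close>)

lemma boundary_add:
  assumes "locally_finite_complex K"
  shows "boundary K (\<lambda>\<sigma>. c \<sigma> + d \<sigma>) = (\<lambda>\<sigma>. boundary K c \<sigma> + boundary K d \<sigma>)"
  by (rule ext) (simp add: boundary_def sum.distrib del: add_bit_eq_xor)

lemma boundary_smult: "boundary K (\<lambda>\<sigma>. a * c \<sigma>) = (\<lambda>\<sigma>. a * boundary K c \<sigma>)"
  by (rule ext) (simp add: boundary_def sum_distrib_left del: mult_bit_eq_and)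

lemma chains_add: "c \<in> chains K n \<Longrightarrow> d \<in> chains K n \<Longrightarrow> (\<lambda>\<sigma>. c \<sigma> + d \<sigma>) \<in> chains K n"
  unfolding chains_def mem_Collect_eq by (metis add.right_neutral)

lemma chains_smult: "c \<in> chains K n \<Longrightarrow> (\<lambda>\<sigma>. a * c \<sigma>) \<in> chains K n"
  unfolding chains_def mem_Collect_eq by (metis mult_zero_right)

lemma boundary_chain:
  assumes "c \<in> chains K (Suc n)"
  shows "boundary K c \<in> chains K n"
proof -
  have "\<sigma> \<in> K \<and> card \<sigma> = Suc n" if "boundary K c \<sigma> \<noteq> 0" for \<sigma>
  proof -
    from that have \<sigma>: "\<sigma> \<in> K" by (auto simp: boundary_def split: if_splits)
    with that have "(\<Sum>\<tau> | \<tau> \<in> K \<and> \<sigma> \<subset> \<tau> \<and> card \<tau> = Suc (card \<sigma>). c \<tau>) \<noteq> 0"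
      by (simp add: boundary_def)
    then obtain \<tau> where "card \<tau> = Suc (card \<sigma>)" "c \<tau> \<noteq> 0"
      by (elim sum.not_neutral_contains_not_neutral) auto
    with assms \<sigma> show ?thesis by (auto simp: chains_def)
  qed
  then show ?thesis by (auto simp: chains_def)
qed

lemma boundary_boundary:
  assumes K: "locally_finite_complex K"
  shows "boundary K (boundary K c) = (\<lambda>_. 0)"
proof
  fix \<sigma>
  show "boundary K (boundary K c) \<sigma> = 0"
  proof (cases "\<sigma> \<in> K")
    case \<sigma>: True
    have fin\<sigma>: "finite \<sigma>" "\<sigma> \<noteq> {}" using \<sigma> K by (auto simp: locally_finite_complex_def)
    let ?T = "{\<tau>. \<tau> \<in> K \<and> \<sigma> \<subset> \<tau> \<and> card \<tau> = Suc (card \<sigma>)}"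
    let ?R = "{\<rho>. \<rho> \<in> K \<and> \<sigma> \<subset> \<rho> \<and> card \<rho> = Suc (Suc (card \<sigma>))}"
    have "boundary K (boundary K c) \<sigma> = (\<Sum>\<tau>\<in>?T. boundary K c \<tau>)"
      using \<sigma> by (simp add: boundary_def[of K "boundary K c"])
    also have "\<dots> = (\<Sum>\<tau>\<in>?T. \<Sum>\<rho> | \<rho> \<in> ?R \<and> \<tau> \<subset> \<rho>. c \<rho>)"
      by (intro sum.cong refl) (auto simp: boundary_def intro!: sum.cong)
    also have "\<dots> = (\<Sum>\<rho>\<in>?R. \<Sum>\<tau> | \<tau> \<in> ?T \<and> \<tau> \<subset> \<rho>. c \<rho>)"
      by (rule sum.swap_restrict) (use finite_cofaces[OF K \<sigma>] in auto)
    also have "\<dots> = (\<Sum>\<rho>\<in>?R. 0)"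
    proof (rule sum.cong[OF refl])
      fix \<rho> assume \<rho>: "\<rho> \<in> ?R"
      then have fin\<rho>: "finite \<rho>" using K by (auto simp: locally_finite_complex_def)
      have "card (\<rho> - \<sigma>) = 2" using \<rho> fin\<sigma> by (subst card_Diff_subset) auto
      then obtain a b where ab: "\<rho> - \<sigma> = {a, b}" "a \<noteq> b" by (auto simp: card_2_iff)
      have sub: "\<tau> \<in> K" if "\<sigma> \<subseteq> \<tau>" "\<tau> \<subseteq> \<rho>" for \<tau>
        using face_closed[OF K, of \<rho> \<tau>] \<rho> that fin\<sigma> by blast
      have "{\<tau>. \<tau> \<in> ?T \<and> \<tau> \<subset> \<rho>} = {insert a \<sigma>, insert b \<sigma>}"
      proof (intro equalityI subsetI)
        fix \<tau> assume "\<tau> \<in> {\<tau>. \<tau> \<in> ?T \<and> \<tau> \<subset> \<rho>}"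
        then have \<tau>: "\<sigma> \<subseteq> \<tau>" "\<tau> \<subseteq> \<rho>" "card \<tau> = Suc (card \<sigma>)" by auto
        then have "card (\<tau> - \<sigma>) = 1" using fin\<sigma> by (simp add: card_Diff_subset)
        then obtain x where x: "\<tau> - \<sigma> = {x}" by (auto simp: card_1_singleton_iff)
        then have "x \<in> {a, b}" using ab \<tau> by blast
        moreover have "\<tau> = insert x \<sigma>" using x \<tau> by blast
        ultimately show "\<tau> \<in> {insert a \<sigma>, insert b \<sigma>}" by auto
      next
        fix \<tau> assume "\<tau> \<in> {insert a \<sigma>, insert b \<sigma>}"
        moreover have "a \<notin> \<sigma>" "b \<notin> \<sigma>" "a \<in> \<rho>" "b \<in> \<rho>" using ab by auto
        ultimately show "\<tau> \<in> {\<tau>. \<tau> \<in> ?T \<and> \<tau> \<subset> \<rho>}"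
          using sub[of \<tau>] \<rho> fin\<sigma> ab(2) by auto
      qed
      moreover have "insert a \<sigma> \<noteq> insert b \<sigma>" using ab by auto
      ultimately have "(\<Sum>\<tau> | \<tau> \<in> ?T \<and> \<tau> \<subset> \<rho>. c \<rho>) = c \<rho> + c \<rho>" by simp
      then show "(\<Sum>\<tau> | \<tau> \<in> ?T \<and> \<tau> \<subset> \<rho>. c \<rho>) = 0" by simp
    qed
    finally show ?thesis by simp
  qed (simp add: boundary_def)
qed

lemma bit_add_self: "(x::bit) + x = 0"
  by simp

lemma cycle_module_module:
  assumes K: "locally_finite_complex K"
  shows "Module.module (class_ring :: bit ring) (cycle_module K n)"
proof (rule Module.moduleI)
  show "cring (class_ring :: bit ring)" by (rule class_cring.is_cring)
  show "abelian_group (cycle_module K n)"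
  proof (rule abelian_groupI)
    fix x y assume "x \<in> carrier (cycle_module K n)" "y \<in> carrier (cycle_module K n)"
    then show "x \<oplus>\<^bsub>cycle_module K n\<^esub> y \<in> carrier (cycle_module K n)"
      by (simp add: cycle_module_def cycles_def chains_add boundary_add[OF K] del: add_bit_eq_xor)
  next
    fix x assume x: "x \<in> carrier (cycle_module K n)"
    have "x \<oplus>\<^bsub>cycle_module K n\<^esub> x = \<zero>\<^bsub>cycle_module K n\<^esub>"
      by (simp add: cycle_module_def bit_add_self del: add_bit_eq_xor)
    with x show "\<exists>y\<in>carrier (cycle_module K n). y \<oplus>\<^bsub>cycle_module K n\<^esub> x = \<zero>\<^bsub>cycle_module K n\<^esub>"
      by blast
  next
    show "\<zero>\<^bsub>cycle_module K n\<^esub> \<in> carrier (cycle_module K n)"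
      by (auto simp: cycle_module_def cycles_def chains_def boundary_def)
  qed (simp_all add: cycle_module_def add_ac del: add_bit_eq_xor)
qed (auto simp: cycle_module_def cycles_def chains_smult boundary_smult algebra_simps
      simp del: add_bit_eq_xor mult_bit_eq_and)

lemma boundaries_submodule:
  assumes K: "locally_finite_complex K"
  shows "LinearCombinations.submodule (class_ring :: bit ring) (boundaries K n) (cycle_module K n)"
proof (rule LinearCombinations.submodule.intro)
  show "Module.module (class_ring :: bit ring) (cycle_module K n)" by (rule cycle_module_module[OF K])
  show "boundaries K n \<subseteq> carrier (cycle_module K n)"
    by (auto simp: boundaries_def cycle_module_def cycles_def boundary_chain boundary_boundary[OF K])
  show "\<zero>\<^bsub>cycle_module K n\<^esub> \<in> boundaries K n"
    unfolding boundaries_def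
    by (rule image_eqI[of _ _ "\<lambda>_. 0"]) (auto simp: cycle_module_def chains_def boundary_def)
next
  fix v w assume "v \<in> boundaries K n" "w \<in> boundaries K n"
  then obtain c d where c: "v = boundary K c" "w = boundary K d"
    "c \<in> chains K (Suc n)" "d \<in> chains K (Suc n)" by (auto simp: boundaries_def)
  then have "(\<lambda>\<sigma>. c \<sigma> + d \<sigma>) \<in> chains K (Suc n)"
    by (simp add: chains_add del: add_bit_eq_xor)
  then show "v \<oplus>\<^bsub>cycle_module K n\<^esub> w \<in> boundaries K n"
    unfolding boundaries_def using c boundary_add[OF K, of c d]
    by (intro image_eqI[of _ _ "\<lambda>\<sigma>. c \<sigma> + d \<sigma>"]) (auto simp: cycle_module_def)
next
  fix a v assume "v \<in> boundaries K n"
  then obtain c where c: "v = boundary K c" "c \<in> chains K (Suc n)" by (auto simp: boundaries_def)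
  then have "(\<lambda>\<sigma>. a * c \<sigma>) \<in> chains K (Suc n)"
    by (simp add: chains_smult del: mult_bit_eq_and)
  then show "a \<odot>\<^bsub>cycle_module K n\<^esub> v \<in> boundaries K n"
    unfolding boundaries_def using c boundary_smult[of K a c]
    by (intro image_eqI[of _ _ "\<lambda>\<sigma>. a * c \<sigma>"]) (auto simp: cycle_module_def)
qed

lemma H_suf_module:
  assumes "locally_finite_complex K"
  shows "Module.module (class_ring :: bit ring) (H_suf K n)"
  unfolding H_suf_def
  by (rule quot_module_module[OF cycle_module_module boundaries_submodule]) (rule assms)+

lemma boundary_subcomplex:
  assumes K: "locally_finite_complex K" and L: "locally_finite_complex L" and "K \<subseteq> L"
    and c: "c \<in> chains K n"
  shows "boundary L c = boundary K c"
proof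
  fix \<sigma>
  have c0: "c \<tau> = 0" if "\<tau> \<notin> K" for \<tau> using c that by (auto simp: chains_def)
  show "boundary L c \<sigma> = boundary K c \<sigma>"
  proof (cases "\<sigma> \<in> K")
    case True
    then have "\<sigma> \<in> L" using assms by auto
    have "(\<Sum>\<tau> | \<tau> \<in> L \<and> \<sigma> \<subset> \<tau> \<and> card \<tau> = Suc (card \<sigma>). c \<tau>)
      = (\<Sum>\<tau> | \<tau> \<in> K \<and> \<sigma> \<subset> \<tau> \<and> card \<tau> = Suc (card \<sigma>). c \<tau>)"
      by (rule sum.mono_neutral_right) (use finite_cofaces[OF L \<open>\<sigma> \<in> L\<close>] \<open>K \<subseteq> L\<close> c0 in auto)
    then show ?thesis using True \<open>\<sigma> \<in> L\<close> by (simp add: boundary_def)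
  next
    case False
    have "c \<tau> = 0" if "\<sigma> \<in> L" "\<sigma> \<subset> \<tau>" for \<tau>
    proof (rule c0, rule notI)
      assume "\<tau> \<in> K"
      moreover have "\<sigma> \<noteq> {}" using L that by (auto simp: locally_finite_complex_def)
      ultimately have "\<sigma> \<in> K" using face_closed[OF K] that by blast
      then show False using False by simp
    qed
    then show ?thesis using False by (simp add: boundary_def)
  qed
qed

abbreviation hcls :: "'v set set \<Rightarrow> nat \<Rightarrow> ('v set \<Rightarrow> bit) \<Rightarrow> ('v set \<Rightarrow> bit) set" where
  "hcls K n z \<equiv> boundaries K n +>\<^bsub>cycle_module K n\<^esub> z"

lemma carrier_H_suf: "carrier (H_suf K n) = hcls K n ` cycles K n"
  unfolding H_suf_def quot_module_def A_RCOSETS_def' by (auto simp: cycle_module_def)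

lemma cycles_mono:
  assumes "locally_finite_complex K" "locally_finite_complex L" "K \<subseteq> L"
  shows "cycles K n \<subseteq> cycles L n"
proof
  fix c assume "c \<in> cycles K n"
  then have c: "c \<in> chains K n" "boundary K c = (\<lambda>_. 0)" by (auto simp: cycles_def)
  then have "c \<in> chains L n" using assms(3) by (auto simp: chains_def)
  with c boundary_subcomplex[OF assms c(1)] show "c \<in> cycles L n" by (simp add: cycles_def)
qed

lemma boundaries_mono:
  assumes "locally_finite_complex K" "locally_finite_complex L" "K \<subseteq> L"
  shows "boundaries K n \<subseteq> boundaries L n"
proof
  fix b assume "b \<in> boundaries K n"
  then obtain c where c: "b = boundary K c" "c \<in> chains K (Suc n)" by (auto simp: boundaries_def)
  then have "b = boundary L c" using boundary_subcomplex[OF assms] by simp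
  moreover have "c \<in> chains L (Suc n)" using c assms by (auto simp: chains_def)
  ultimately show "b \<in> boundaries L n" by (auto simp: boundaries_def)
qed

lemma hcls_mem: "w \<in> hcls K n z \<longleftrightarrow> (\<exists>b\<in>boundaries K n. w = (\<lambda>\<sigma>. b \<sigma> + z \<sigma>))"
  unfolding a_r_coset_def' cycle_module_def by (simp del: add_bit_eq_xor)

lemma boundaries_sg:
  assumes K: "locally_finite_complex K"
  shows "abelian_subgroup (boundaries K n) (cycle_module K n)"
  by (rule submodule_abelian_subgroup[OF cycle_module_module boundaries_submodule]) (rule K)+

lemma hcls_self:
  assumes K: "locally_finite_complex K"
  shows "z \<in> hcls K n z"
proof -
  have "(\<lambda>_. 0) \<in> boundaries K n"
    using LinearCombinations.submodule.zero_closed[OF boundaries_submodule[OF K]]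
    by (simp add: cycle_module_def)
  then show ?thesis unfolding hcls_mem by (rule bexI[rotated]) (simp del: add_bit_eq_xor)
qed

lemma hcls_eq:
  assumes K: "locally_finite_complex K" and z: "z \<in> cycles K n" and w: "w \<in> hcls K n z"
  shows "hcls K n w = hcls K n z"
proof -
  interpret S: abelian_subgroup "boundaries K n" "cycle_module K n"
    by (rule boundaries_sg[OF K])
  show ?thesis
    using S.a_repr_independence[OF w _ S.a_subgroup] z by (simp add: cycle_module_def)
qed

lemma H_suf_map_hcls:
  assumes KL: "locally_finite_complex K" "locally_finite_complex L" "K \<subseteq> L"
    and z: "z \<in> cycles K n"
  shows "H_suf_map L n (hcls K n z) = hcls L n z"
proof -
  have zL: "z \<in> cycles L n" using cycles_mono[OF KL] z by blast
  have "hcls L n w = hcls L n z" if w: "w \<in> hcls K n z" for w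
  proof (rule hcls_eq[OF KL(2) zL])
    show "w \<in> hcls L n z" using w boundaries_mono[OF KL] unfolding hcls_mem by blast
  qed
  moreover have "z \<in> hcls K n z" by (rule hcls_self[OF KL(1)])
  ultimately show ?thesis unfolding H_suf_map_def by blast
qed

lemma hcls_add:
  assumes K: "locally_finite_complex K" and "z \<in> cycles K n" "w \<in> cycles K n"
  shows "hcls K n z \<oplus>\<^bsub>H_suf K n\<^esub> hcls K n w = hcls K n (\<lambda>\<sigma>. z \<sigma> + w \<sigma>)"
proof -
  interpret S: abelian_subgroup "boundaries K n" "cycle_module K n"
    by (rule boundaries_sg[OF K])
  show ?thesis using S.a_rcos_sum[of z w] assms
    by (simp add: H_suf_def quot_module_def cycle_module_def del: add_bit_eq_xor)
qed

lemma hcls_smult: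
  assumes K: "locally_finite_complex K" and z: "z \<in> cycles K n"
  shows "a \<odot>\<^bsub>H_suf K n\<^esub> hcls K n z = hcls K n (\<lambda>\<sigma>. a * z \<sigma>)"
proof -
  interpret M: Module.module "class_ring :: bit ring" "cycle_module K n"
    by (rule cycle_module_module[OF K])
  interpret N: LinearCombinations.submodule "class_ring :: bit ring" "boundaries K n" "cycle_module K n"
    by (rule boundaries_submodule[OF K])
  have az: "(\<lambda>\<sigma>. a * z \<sigma>) \<in> cycles K n"
    using M.smult_closed[of a z] z by (simp add: cycle_module_def)
  have "hcls K n (\<lambda>\<sigma>. a * w \<sigma>) = hcls K n (\<lambda>\<sigma>. a * z \<sigma>)" if w: "w \<in> hcls K n z" for w
  proof (rule hcls_eq[OF K az])
    obtain b where b: "b \<in> boundaries K n" "w = (\<lambda>\<sigma>. b \<sigma> + z \<sigma>)" using w by (auto simp: hcls_mem)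
    have "(\<lambda>\<sigma>. a * b \<sigma>) \<in> boundaries K n"
      using N.smult_closed[of a b] b by (simp add: cycle_module_def)
    then show "(\<lambda>\<sigma>. a * w \<sigma>) \<in> hcls K n (\<lambda>\<sigma>. a * z \<sigma>)"
      unfolding hcls_mem
      by (rule bexI[rotated]) (simp add: b distrib_left del: add_bit_eq_xor mult_bit_eq_and)
  qed
  moreover have "z \<in> hcls K n z" by (rule hcls_self[OF K])
  ultimately have "(\<Union>w\<in>hcls K n z. hcls K n (\<lambda>\<sigma>. a * w \<sigma>)) = hcls K n (\<lambda>\<sigma>. a * z \<sigma>)" by blast
  moreover have "smult (cycle_module K n) a w = (\<lambda>\<sigma>. a * w \<sigma>)" for w
    by (simp add: cycle_module_def del: mult_bit_eq_and)
  ultimately show ?thesis by (simp add: H_suf_def quot_module_def del: mult_bit_eq_and)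
qed


lemma H_suf_direct_system:
  assumes K: "\<And>r. locally_finite_complex (K r)" and mono: "\<And>r s. r \<le> s \<Longrightarrow> K r \<subseteq> K s"
  shows "direct_system (class_ring :: bit ring) (\<lambda>r. H_suf (K r) n) (\<lambda>r s. H_suf_map (K s) n)"
proof (rule direct_system.intro)
  fix r show "Module.module (class_ring :: bit ring) (H_suf (K r) n)" by (rule H_suf_module[OF K])
next
  fix r s :: nat assume rs: "r \<le> s"
  have M: "Module.module (class_ring :: bit ring) (cycle_module (K r) n)"
    by (rule cycle_module_module[OF K])
  have add: "(\<lambda>\<sigma>. z \<sigma> + w \<sigma>) \<in> cycles (K r) n" if "z \<in> cycles (K r) n" "w \<in> cycles (K r) n" for z w
    using that by (simp add: cycles_def chains_add boundary_add[OF K] del: add_bit_eq_xor)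
  have sm: "(\<lambda>\<sigma>. a * z \<sigma>) \<in> cycles (K r) n" if "z \<in> cycles (K r) n" for z a
    using that by (simp add: cycles_def chains_smult boundary_smult del: mult_bit_eq_and)
  have c: "z \<in> cycles (K s) n" if "z \<in> cycles (K r) n" for z
    using cycles_mono[OF K K mono[OF rs]] that by blast
  show "H_suf_map (K s) n \<in> LinearCombinations.module_hom (class_ring :: bit ring)
      (H_suf (K r) n) (H_suf (K s) n)"
    unfolding LinearCombinations.module_hom_def
    by (auto simp: carrier_H_suf hcls_add[OF K] hcls_smult[OF K] add sm c
        H_suf_map_hcls[OF K K mono[OF rs]] simp del: add_bit_eq_xor mult_bit_eq_and)
next
  fix r x assume "x \<in> carrier (H_suf (K r) n)"
  then show "H_suf_map (K r) n x = x"
    by (auto simp: carrier_H_suf H_suf_map_hcls[OF K K])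
next
  fix r s t x assume rst: "r \<le> s" "s \<le> t" and x: "x \<in> carrier (H_suf (K r) n)"
  have rt: "r \<le> t" using rst by simp
  obtain z where z: "z \<in> cycles (K r) n" "x = hcls (K r) n z" using x by (auto simp: carrier_H_suf)
  then have "z \<in> cycles (K s) n" using cycles_mono[OF K K mono[OF rst(1)]] by blast
  then show "H_suf_map (K t) n (H_suf_map (K s) n x) = H_suf_map (K t) n x"
    by (simp add: z H_suf_map_hcls[OF K K mono[OF rst(1)]] H_suf_map_hcls[OF K K mono[OF rst(2)]]
        H_suf_map_hcls[OF K K mono[OF rt]])
qed

lemma rips_mono: "r \<le> s \<Longrightarrow> rips V E r \<subseteq> rips V E s"
  unfolding rips_def by (fastforce intro: order_trans[of _ "enat r" "enat s"])

lemma graph_dist_le_iff: "graph_dist E u v \<le> enat r \<longleftrightarrow> (\<exists>p\<in>walks E u v. length p \<le> Suc r)"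
proof
  assume le: "graph_dist E u v \<le> enat r"
  then have ne: "walks E u v \<noteq> {}" by (auto simp: graph_dist_def top_enat_def)
  then obtain q where "q \<in> walks E u v" by blast
  then have "graph_dist E u v \<in> (\<lambda>p. enat (length p - 1)) ` walks E u v"
    unfolding graph_dist_def by (intro wellorder_InfI[of "enat (length q - 1)"]) simp
  with le show "\<exists>p\<in>walks E u v. length p \<le> Suc r" by force
next
  assume "\<exists>p\<in>walks E u v. length p \<le> Suc r"
  then obtain p where p: "p \<in> walks E u v" "length p \<le> Suc r" by blast
  have "graph_dist E u v \<le> enat (length p - 1)"
    unfolding graph_dist_def using p by (intro INF_lower)
  also have "\<dots> \<le> enat r" using p by simp
  finally show "graph_dist E u v \<le> enat r" .
qed

lemma finite_ball:
  assumes G: "ulf_graph V E"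
  shows "u \<in> V \<Longrightarrow> finite {v. graph_dist E u v \<le> enat r}"
proof (induction r arbitrary: u)
  case 0
  have "{v. graph_dist E u v \<le> enat 0} \<subseteq> {u}"
    by (auto simp: graph_dist_le_iff walks_def le_Suc_eq length_Suc_conv)
  then show ?case by (rule finite_subset) simp
next
  case (Suc r)
  let ?N = "{w. {u, w} \<in> E}"
  have N: "finite ?N" "?N \<subseteq> V" using G Suc.prems by (auto simp: ulf_graph_def)
  have "{v. graph_dist E u v \<le> enat (Suc r)} \<subseteq> {u} \<union> (\<Union>w\<in>?N. {v. graph_dist E w v \<le> enat r})"
  proof
    fix v assume "v \<in> {v. graph_dist E u v \<le> enat (Suc r)}"
    then obtain p where p: "p \<in> walks E u v" "length p \<le> Suc (Suc r)"
      by (auto simp: graph_dist_le_iff)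
    then obtain q where q: "p = u # q" by (cases p) (auto simp: walks_def)
    show "v \<in> {u} \<union> (\<Union>w\<in>?N. {v. graph_dist E w v \<le> enat r})"
    proof (cases q)
      case Nil
      then show ?thesis using p q by (simp add: walks_def)
    next
      case (Cons w q')
      have step: "{p ! i, p ! Suc i} \<in> E" if "Suc i < length p" for i
        using p(1) that by (auto simp: walks_def)
      have "{u, w} \<in> E" using step[of 0] q Cons by simp
      moreover have "q \<in> walks E w v"
        using p(1) q Cons step[of "Suc i" for i] by (auto simp: walks_def)
      moreover have "length q \<le> Suc r" using p q by simp
      ultimately show ?thesis by (auto simp: graph_dist_le_iff)
    qed
  qed
  moreover have "finite ({u} \<union> (\<Union>w\<in>?N. {v. graph_dist E w v \<le> enat r}))"
    using N Suc.IH by auto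
  ultimately show ?case by (rule finite_subset)
qed

lemma rips_locally_finite:
  assumes G: "ulf_graph V E"
  shows "locally_finite_complex (rips V E r)"
proof -
  have "finite {\<tau> \<in> rips V E r. \<sigma> \<subseteq> \<tau>}" if \<sigma>: "\<sigma> \<in> rips V E r" for \<sigma>
  proof -
    obtain u where u: "u \<in> \<sigma>" "u \<in> V" using \<sigma> by (auto simp: rips_def)
    have "{\<tau> \<in> rips V E r. \<sigma> \<subseteq> \<tau>} \<subseteq> Pow {v. graph_dist E u v \<le> enat r}"
      using u by (auto simp: rips_def)
    then show ?thesis by (rule finite_subset) (simp add: finite_ball[OF G u(2)])
  qed
  moreover have "\<rho> \<in> rips V E r" if "\<sigma> \<in> rips V E r" "\<rho> \<subseteq> \<sigma>" "\<rho> \<noteq> {}" for \<sigma> \<rho>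
  proof -
    have "finite \<rho>" using that finite_subset[of \<rho> \<sigma>] by (simp add: rips_def)
    then show ?thesis using that unfolding rips_def by blast
  qed
  moreover have "{} \<notin> rips V E r" "\<And>\<sigma>. \<sigma> \<in> rips V E r \<Longrightarrow> finite \<sigma>" by (auto simp: rips_def)
  ultimately show ?thesis
    unfolding locally_finite_complex_def by blast
qed

theorem H_uf_vectorspace:
  assumes "ulf_graph V E"
  shows "vectorspace (class_ring :: bit ring) (H_uf V E n)"
proof -
  interpret direct_system "class_ring :: bit ring" "\<lambda>r. H_suf (rips V E r) n"
      "\<lambda>r s. H_suf_map (rips V E s) n"
    by (rule H_suf_direct_system) (simp_all add: rips_locally_finite[OF assms] rips_mono)
  show ?thesis unfolding vectorspace_def H_uf_def
    using direct_limit_module class_field.field_axioms by blast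
qed

lemma circuit_vec_eq_indicator:
  assumes "distinct c" "length c \<ge> 3"
  shows "circuit_vec c e = of_bool (\<exists>i<length c. e = {c ! i, c ! (Suc i mod length c)})"
proof (cases "\<exists>i<length c. e = {c ! i, c ! (Suc i mod length c)}")
  case True
  then obtain i where i: "i < length c" "e = {c ! i, c ! (Suc i mod length c)}" by blast
  have "j = i" if j: "j < length c" "{c ! j, c ! (Suc j mod length c)} = e" for j
  proof (rule ccontr)
    assume "j \<noteq> i"
    have m: "Suc i mod length c < length c" "Suc j mod length c < length c" using assms by (auto intro!: mod_less_divisor)
    have "c ! j \<noteq> c ! i" using \<open>j \<noteq> i\<close> i j assms by (simp add: nth_eq_iff_index_eq)
    then have "c ! j = c ! (Suc i mod length c)" "c ! i = c ! (Suc j mod length c)"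
      using i(2) j(2) by (auto simp: doubleton_eq_iff)
    then have "j = Suc i mod length c" "i = Suc j mod length c"
      using i j m assms by (auto simp: nth_eq_iff_index_eq)
    then show False using assms(2) i(1) j(1)
      by (auto simp: mod_Suc split: if_splits)
  qed
  then have "{j. j < length c \<and> {c ! j, c ! (Suc j mod length c)} = e} = {i}" using i by blast
  then show ?thesis using True by (simp add: circuit_vec_def)
next
  case False
  then have "{j. j < length c \<and> {c ! j, c ! (Suc j mod length c)} = e} = {}" by blast
  then show ?thesis using False unfolding circuit_vec_def by (simp only: card.empty of_nat_0 of_bool_eq)
qed

lemma thin_sums_arbitrary_index:
  fixes I :: "'i set" and f :: "'i \<Rightarrow> 'v set \<Rightarrow> bit"
  assumes thin: "thin E I f" and S: "f ` I \<subseteq> S" and supp: "\<And>i e. i \<in> I \<Longrightarrow> f i e \<noteq> 0 \<Longrightarrow> e \<in> E"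
  shows "thin_sum I f \<in> thin_sums E S"
proof -
  define I' where "I' = {i \<in> I. \<exists>e. f i e \<noteq> 0}"
  have "\<forall>i\<in>I'. \<exists>e. f i e \<noteq> 0" by (simp add: I'_def)
  then obtain edge where edge: "\<And>i. i \<in> I' \<Longrightarrow> f i (edge i) \<noteq> 0" by (metis bchoice)
  define fib where "fib e = {i \<in> I'. edge i = e}" for e
  have "finite (fib e)" for e
  proof (cases "e \<in> E")
    case True
    have "fib e \<subseteq> {i \<in> I. f i e \<noteq> 0}" using edge by (auto simp: fib_def I'_def)
    then show ?thesis using thin True by (auto simp: thin_def intro: finite_subset)
  next
    case False
    then have "fib e = {}" using edge supp by (force simp: fib_def I'_def)
    then show ?thesis by simp
  qed
  then have "\<exists>h :: 'i \<Rightarrow> nat. inj_on h (fib e)" for e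
    using finite_imp_inj_to_nat_seg by metis
  then obtain h :: "'v set \<Rightarrow> 'i \<Rightarrow> nat" where h: "\<And>e. inj_on (h e) (fib e)" by metis
  define g where "g i = (edge i, h (edge i) i)" for i
  have g: "inj_on g I'"
  proof (rule inj_onI)
    fix i j assume "i \<in> I'" "j \<in> I'" "g i = g j"
    then show "i = j" using h[of "edge i"] by (auto simp: g_def fib_def inj_on_def)
  qed
  define f' where "f' = f \<circ> inv_into I' g"
  have f': "f' (g i) = f i" if "i \<in> I'" for i using g that by (simp add: f'_def)
  have sets: "{k. k \<in> g ` I' \<and> f' k e \<noteq> 0} = g ` {i. i \<in> I \<and> f i e \<noteq> 0}" for e
  proof (intro equalityI subsetI)
    fix k assume "k \<in> {k. k \<in> g ` I' \<and> f' k e \<noteq> 0}"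
    then obtain i where i: "i \<in> I'" "k = g i" "f' k e \<noteq> 0" by blast
    then have "f i e \<noteq> 0" using f'[of i] by simp
    then show "k \<in> g ` {i. i \<in> I \<and> f i e \<noteq> 0}" using i by (auto simp: I'_def)
  next
    fix k assume "k \<in> g ` {i. i \<in> I \<and> f i e \<noteq> 0}"
    then obtain i where i: "i \<in> I" "k = g i" "f i e \<noteq> 0" by blast
    then have "i \<in> I'" by (auto simp: I'_def)
    then show "k \<in> {k. k \<in> g ` I' \<and> f' k e \<noteq> 0}" using i f'[of i] by simp
  qed
  have "thin E (g ` I') f'"
    using thin sets by (auto simp: thin_def simp del: bit_not_zero_iff)
  moreover have "f' ` (g ` I') \<subseteq> S"
  proof (intro subsetI, elim imageE, hypsubst)
    fix i assume "i \<in> I'"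
    then show "f' (g i) \<in> S" using S f'[of i] by (auto simp: I'_def)
  qed
  moreover have "thin_sum I f = thin_sum (g ` I') f'"
  proof
    fix e
    have sub: "{i. i \<in> I \<and> f i e \<noteq> 0} \<subseteq> I'" by (auto simp: I'_def)
    show "thin_sum I f e = thin_sum (g ` I') f' e"
      unfolding thin_sum_def sets sum.reindex[OF inj_on_subset[OF g sub]]
      using sub f' by (intro sum.cong refl) (simp add: subset_iff)
  qed
  ultimately show ?thesis unfolding thin_sums_def by blast
qed

end

theory Submission
  imports Defs "HOL-Analysis.Urysohn"
begin

text \<open>Let \<open>Z\<close> be the group of \<open>\<int>/2\<close>-cycles of the graph with arbitrary support, and let \<open>B r\<close> be
  the group of 1-boundaries of the Rips complex at scale \<open>r\<close>. In the product topology \<open>Z\<close> is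
  compact and each \<open>B r\<close> is closed, being a continuous image of the compact group of 2-chains.
  If the homology had finite dimension over \<open>\<int>/2\<close>, then \<open>Z\<close> would be a countable union of closed
  cosets of the groups \<open>Z \<inter> B r\<close>. By Baire one of these groups would be open in \<open>Z\<close>, hence of
  finite index, and the increasing sequence \<open>Z \<inter> B r\<close> would be constant from some scale \<open>R\<close> on.
  Every circuit bounds at some scale (take a cone), hence it would bound at scale \<open>R\<close>. Replacing
  the edges of the Rips complex by walks of length at most \<open>R\<close> then writes every circuit as a thin
  sum of circuits of length at most \<open>3 * R\<close>, contradicting the existence of large circuits.\<close>

declare add_bit_eq_xor [simp del] mult_bit_eq_and [simp del]

section \<open>Edge vectors of walks\<close>

text \<open>An open counterpart of \<open>circuit_vec\<close>: edges are counted modulo 2 along the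
  list, with no closing edge, so that concatenating walks becomes addition.\<close>

fun path_vec :: "'v list \<Rightarrow> 'v set \<Rightarrow> bit" where
  "path_vec (x # y # ys) e = of_bool ({x, y} = e) + path_vec (y # ys) e"
| "path_vec _ e = 0"

text \<open>Taking \<open>tl q\<close> removes the second copy of the shared vertex, so the edges of
  the joined list are exactly those of \<open>p\<close> followed by those of
  \<open>q\<close>.\<close>

lemma path_vec_append:
  assumes "p \<noteq> []" "q \<noteq> []" "last p = hd q"
  shows "path_vec (p @ tl q) e = path_vec p e + path_vec q e"
  using assms
proof (induction p e rule: path_vec.induct)
  case (1 x y ys e)
  then show ?case by (simp add: add.assoc)
next
  case ("2_2" v e)
  then show ?case by (cases q) simp_all
qed simp

text \<open>Edges are undirected; this is what lets an unordered pair of vertices be assigned one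
  edge vector.\<close>

lemma path_vec_rev: "path_vec (rev p) e = path_vec p e"
proof (induction p e rule: path_vec.induct)
  case (1 x y ys e)
  have "path_vec (rev (x # y # ys)) e = path_vec (rev (y # ys) @ tl [y, x]) e" by simp
  also have "\<dots> = path_vec (rev (y # ys)) e + path_vec [y, x] e"
    by (rule path_vec_append) simp_all
  finally show ?case using 1 by (simp add: insert_commute add.commute)
qed simp_all

lemma path_vec_conv_sum:
  "path_vec p e = (\<Sum>i<length p - 1. of_bool ({p ! i, p ! Suc i} = e))"
proof (induction p e rule: path_vec.induct)
  case (1 x y ys e)
  have "(\<Sum>i<Suc (length ys). of_bool ({(x # y # ys) ! i, (x # y # ys) ! Suc i} = e) :: bit)
    = of_bool ({x, y} = e) + (\<Sum>i<length ys. of_bool ({(y # ys) ! i, (y # ys) ! Suc i} = e))"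
    by (subst sum.lessThan_Suc_shift) simp
  with 1 show ?case by simp
qed simp_all

lemma path_vec_support:
  "path_vec p e \<noteq> 0 \<Longrightarrow> \<exists>i. Suc i < length p \<and> e = {p ! i, p ! Suc i}"
proof (induction p e rule: path_vec.induct)
  case (1 x y ys e)
  show ?case
  proof (cases "{x, y} = e")
    case True
    then show ?thesis by (intro exI[of _ 0]) simp
  next
    case False
    then obtain i where "Suc i < length (y # ys)" "e = {(y # ys) ! i, (y # ys) ! Suc i}"
      using 1 by auto
    then show ?thesis by (intro exI[of _ "Suc i"]) simp
  qed
qed simp_all

text \<open>Repeating the first vertex at the end turns the cyclic indexing of circuits into the
  linear indexing of walks.\<close>

lemma nth_close_list:
  "i < length c \<Longrightarrow> (c @ [hd c]) ! Suc i = c ! (Suc i mod length c)"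
  by (cases "c = []"; cases "Suc i = length c") (auto simp: nth_append hd_conv_nth)

lemma circuit_vec_eq_path_vec:
  assumes "c \<noteq> []"
  shows "circuit_vec c = path_vec (c @ [hd c])"
proof
  fix e
  have "circuit_vec c e = (\<Sum>i<length c. of_bool ({c ! i, c ! (Suc i mod length c)} = e))"
    unfolding circuit_vec_def by (simp add: sum_of_bool_eq Int_def)
  also have "\<dots> = (\<Sum>i<length c. of_bool ({(c @ [hd c]) ! i, (c @ [hd c]) ! Suc i} = e))"
    by (intro sum.cong refl) (simp add: nth_close_list, simp add: nth_append)
  finally show "circuit_vec c e = path_vec (c @ [hd c]) e" by (simp add: path_vec_conv_sum)
qed

lemma walks_iff_successively:
  "p \<in> walks E u v \<longleftrightarrow>
    p \<noteq> [] \<and> hd p = u \<and> last p = v \<and> successively (\<lambda>x y. {x, y} \<in> E) p"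
  by (simp add: walks_def successively_conv_nth)

lemma circuit_iff_walk:
  "circuit E c \<longleftrightarrow> c \<noteq> [] \<and> c @ [hd c] \<in> walks E (hd c) (hd c)"
proof -
  have "{(c @ [hd c]) ! i, (c @ [hd c]) ! Suc i} = {c ! i, c ! (Suc i mod length c)}"
    if "i < length c" for i
    using that by (simp add: nth_close_list) (simp add: nth_append)
  then show ?thesis by (auto simp: circuit_def walks_def)
qed

lemma circuit_vec_support:
  assumes "circuit E c" "circuit_vec c e \<noteq> 0"
  shows "e \<in> E"
proof -
  have c: "c \<noteq> []" "c @ [hd c] \<in> walks E (hd c) (hd c)" using assms(1) by (auto simp: circuit_iff_walk)
  then obtain i where "Suc i < length (c @ [hd c])" "e = {(c @ [hd c]) ! i, (c @ [hd c]) ! Suc i}"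
    using path_vec_support[of "c @ [hd c]" e] assms(2) circuit_vec_eq_path_vec[of c] by auto
  then show ?thesis using c by (auto simp: walks_def)
qed

text \<open>A closed walk lists its starting vertex twice and a circuit only once; two vertices at
  least keep the circuit nonempty after \<open>butlast\<close>.\<close>

lemma closed_walk_circuit:
  assumes p: "p \<in> walks E u u" and len: "2 \<le> length p"
  shows "circuit E (butlast p)" "circuit_vec (butlast p) = path_vec p"
proof -
  have ne: "butlast p \<noteq> []" using len by (cases p rule: rev_cases) auto
  moreover have "p = butlast p @ [u]"
    using p append_butlast_last_id[of p] unfolding walks_def by force
  moreover have "hd (butlast p) = u" using p ne by (cases p) (auto simp: walks_def split: if_splits)
  ultimately have "p = butlast p @ [hd (butlast p)]" by simp
  then show "circuit E (butlast p)" "circuit_vec (butlast p) = path_vec p"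
    using ne p \<open>hd (butlast p) = u\<close> circuit_vec_eq_path_vec[OF ne] by (auto simp: circuit_iff_walk)
qed

section \<open>Operations on walks and their effect on the graph metric\<close>

lemma walk_append:
  assumes "p \<in> walks E u v" "q \<in> walks E v w"
  shows "p @ tl q \<in> walks E u w"
  using assms by (cases q) (auto simp: walks_iff_successively successively_append_iff
      successively_Cons last_append)

lemma walk_rev: "p \<in> walks E u v \<Longrightarrow> rev p \<in> walks E v u"
  by (auto simp: walks_iff_successively hd_rev last_rev insert_commute)

lemma graph_dist_le_commute:
  "graph_dist E u v \<le> enat r \<Longrightarrow> graph_dist E v u \<le> enat r"
  unfolding graph_dist_le_iff using walk_rev length_rev by metis

lemma graph_dist_le_triangle:
  assumes "graph_dist E u v \<le> enat r" "graph_dist E v w \<le> enat s"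
  shows "graph_dist E u w \<le> enat (r + s)"
proof -
  obtain p q where "p \<in> walks E u v" "length p \<le> Suc r" "q \<in> walks E v w" "length q \<le> Suc s"
    using assms by (auto simp: graph_dist_le_iff)
  then show ?thesis unfolding graph_dist_le_iff
    by (intro bexI[of _ "p @ tl q"]) (auto simp: walk_append)
qed

lemma graph_dist_walk_vertex:
  assumes p: "p \<in> walks E u v" "length p \<le> Suc r" "x \<in> set p"
  shows "graph_dist E u x \<le> enat r"
proof -
  obtain ys zs where ys: "p = ys @ x # zs" using p(3) by (auto simp: in_set_conv_decomp)
  then have "ys @ [x] \<in> walks E u x" using p(1)
    by (cases ys) (auto simp: walks_iff_successively successively_append_iff successively_Cons
        hd_append split: if_splits)
  moreover have "length (ys @ [x]) \<le> Suc r" using ys p(2) by simp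
  ultimately show ?thesis unfolding graph_dist_le_iff by blast
qed

lemma walk_vertices_in_V:
  assumes G: "ulf_graph V E" and p: "p \<in> walks E u v" and u: "u \<in> V"
  shows "set p \<subseteq> V"
proof
  fix x assume "x \<in> set p"
  then obtain i where i: "i < length p" "x = p ! i" by (auto simp: in_set_conv_nth)
  show "x \<in> V"
  proof (cases i)
    case 0
    then show ?thesis using i p u by (simp add: walks_def hd_conv_nth)
  next
    case (Suc j)
    then have "{p ! j, p ! i} \<in> E" using p i by (simp add: walks_def)
    then show ?thesis using G i by (auto simp: ulf_graph_def)
  qed
qed

section \<open>Circuits bound in Rips complexes\<close>

text \<open>Nonempty proper faces of \<tau> belong to the complex and see \<tau> as the only
  contributing coface. The empty face is excluded because there is no augmentation.\<close>

lemma boundary_simplex: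
  assumes K: "locally_finite_complex K" and \<tau>: "\<tau> \<in> K"
  shows "boundary K (\<lambda>\<rho>. of_bool (\<rho> = \<tau>)) \<sigma>
    = of_bool (\<sigma> \<noteq> {} \<and> \<sigma> \<subset> \<tau> \<and> card \<tau> = Suc (card \<sigma>))"
proof (cases "\<sigma> \<in> K")
  case True
  have "(\<Sum>\<rho> | \<rho> \<in> K \<and> \<sigma> \<subset> \<rho> \<and> card \<rho> = Suc (card \<sigma>). of_bool (\<rho> = \<tau>))
    = (of_bool (\<sigma> \<subset> \<tau> \<and> card \<tau> = Suc (card \<sigma>)) :: bit)"
    using finite_cofaces[OF K True] \<tau> by (simp add: of_bool_def)
  moreover have "\<sigma> \<noteq> {}" using K True by (auto simp: locally_finite_complex_def)
  ultimately show ?thesis using True by (simp add: boundary_def)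
next
  case False
  then have "\<not> (\<sigma> \<noteq> {} \<and> \<sigma> \<subset> \<tau>)" using face_closed[OF K \<tau>, of \<sigma>] by blast
  then show ?thesis using False by (auto simp: boundary_def)
qed

lemma two_subsets_of_triple:
  assumes "a \<noteq> b" "b \<noteq> c" "a \<noteq> c"
  shows "\<sigma> \<subset> {a, b, c} \<and> card \<sigma> = 2 \<longleftrightarrow> \<sigma> = {a, b} \<or> \<sigma> = {b, c} \<or> \<sigma> = {a, c}"
proof
  assume *: "\<sigma> \<subset> {a, b, c} \<and> card \<sigma> = 2"
  then obtain x y where "\<sigma> = {x, y}" "x \<noteq> y" by (auto simp: card_2_iff)
  then show "\<sigma> = {a, b} \<or> \<sigma> = {b, c} \<or> \<sigma> = {a, c}" using * by auto
next
  assume "\<sigma> = {a, b} \<or> \<sigma> = {b, c} \<or> \<sigma> = {a, c}"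
  moreover have proper: "A \<subset> insert x A" if "x \<notin> A" for x :: 'a and A using that by blast
  moreover have "{a, b} \<subset> {a, b, c}" "{b, c} \<subset> {a, b, c}" "{a, c} \<subset> {a, b, c}"
    using proper[of c "{a, b}"] proper[of a "{b, c}"] proper[of b "{a, c}"] assms
    by (simp_all add: insert_commute)
  moreover have "card {a, b} = 2" "card {b, c} = 2" "card {a, c} = 2"
    using assms by simp_all
  ultimately show "\<sigma> \<subset> {a, b, c} \<and> card \<sigma> = 2" by metis
qed

text \<open>Degenerate edges are set to zero, so formulas for triangles persist when vertices
  coincide.\<close>

definition edge_vec :: "'v \<Rightarrow> 'v \<Rightarrow> 'v set \<Rightarrow> bit" where
  "edge_vec a b \<sigma> = of_bool (a \<noteq> b \<and> \<sigma> = {a, b})"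

lemma boundaries_zero:
  assumes K: "locally_finite_complex K"
  shows "(\<lambda>_. 0) \<in> boundaries K n"
  using LinearCombinations.submodule.zero_closed[OF boundaries_submodule[OF K]]
  by (simp add: cycle_module_def)

lemma boundaries_add:
  assumes K: "locally_finite_complex K" and "b \<in> boundaries K n" "c \<in> boundaries K n"
  shows "(\<lambda>\<sigma>. b \<sigma> + c \<sigma>) \<in> boundaries K n"
  using LinearCombinations.submodule.m_closed[OF boundaries_submodule[OF K], of b n c] assms(2,3)
  by (simp add: cycle_module_def)

text \<open>If two vertices coincide, one edge is degenerate and the other two cancel modulo 2. This
  case does occur in cones, whose apex may lie on the walk.\<close>

lemma triangle_boundary:
  assumes K: "locally_finite_complex K" and \<tau>: "{a, b, c} \<in> K"
  shows "(\<lambda>\<sigma>. edge_vec a b \<sigma> + edge_vec b c \<sigma> + edge_vec a c \<sigma>) \<in> boundaries K 1"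
proof (cases "a \<noteq> b \<and> b \<noteq> c \<and> a \<noteq> c")
  case True
  then have card3: "card {a, b, c} = 3" by simp
  have "(\<sigma> \<noteq> {} \<and> \<sigma> \<subset> {a, b, c} \<and> card {a, b, c} = Suc (card \<sigma>))
    \<longleftrightarrow> \<sigma> = {a, b} \<or> \<sigma> = {b, c} \<or> \<sigma> = {a, c}" for \<sigma>
  proof -
    have "card {a, b, c} = Suc (card \<sigma>) \<longleftrightarrow> card \<sigma> = 2" unfolding card3 by auto
    moreover have "card \<sigma> = 2 \<Longrightarrow> \<sigma> \<noteq> {}" by auto
    ultimately show ?thesis using two_subsets_of_triple[of a b c \<sigma>] True by argo
  qed
  then have "boundary K (\<lambda>\<rho>. of_bool (\<rho> = {a, b, c}))
    = (\<lambda>\<sigma>. edge_vec a b \<sigma> + edge_vec b c \<sigma> + edge_vec a c \<sigma>)"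
    unfolding boundary_simplex[OF K \<tau>, abs_def] fun_eq_iff
    using True by (auto simp: edge_vec_def doubleton_eq_iff)
  moreover have "(\<lambda>\<rho>. of_bool (\<rho> = {a, b, c})) \<in> chains K (Suc 1)"
    using \<tau> card3 by (auto simp: chains_def)
  ultimately show ?thesis unfolding boundaries_def by (metis image_eqI)
next
  case False
  then have "(\<lambda>\<sigma>. edge_vec a b \<sigma> + edge_vec b c \<sigma> + edge_vec a c \<sigma>) = (\<lambda>_. 0)"
    by (auto simp: edge_vec_def fun_eq_iff insert_commute)
  then show ?thesis using boundaries_zero[OF K] by simp
qed

text \<open>The filling chain is the cone with apex \<open>a\<close> over the walk \<open>p\<close>.\<close>

lemma cone_boundary:
  assumes K: "locally_finite_complex K"
    and tri: "\<And>x y. x \<in> set p \<Longrightarrow> y \<in> set p \<Longrightarrow> {a, x, y} \<in> K"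
    and succ: "successively (\<noteq>) p" and ne: "p \<noteq> []"
  shows "(\<lambda>e. path_vec p e + edge_vec a (hd p) e + edge_vec a (last p) e) \<in> boundaries K 1"
  using tri succ ne
proof (induction p rule: induct_list012)
  case (2 x)
  then show ?case using boundaries_zero[OF K] by (simp add: add.assoc)
next
  case (3 x y zs)
  let ?q = "\<lambda>e. path_vec (y # zs) e + edge_vec a y e + edge_vec a (last (y # zs)) e"
  let ?t = "\<lambda>e. edge_vec a x e + edge_vec x y e + edge_vec a y e"
  have "?q \<in> boundaries K 1" using 3 by simp
  moreover have "?t \<in> boundaries K 1" by (rule triangle_boundary[OF K]) (simp add: 3)
  ultimately have "(\<lambda>e. ?q e + ?t e) \<in> boundaries K 1" by (rule boundaries_add[OF K])
  \<comment> \<open>The spoke from \<open>a\<close> to \<open>y\<close> belongs to both chains and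
    cancels modulo 2.\<close>
  moreover have "(\<lambda>e. ?q e + ?t e)
    = (\<lambda>e. path_vec (x # y # zs) e + edge_vec a x e + edge_vec a (last (y # zs)) e)"
  proof
    fix e
    have "edge_vec x y e = of_bool ({x, y} = e)" using 3 by (auto simp: edge_vec_def)
    then show "?q e + ?t e = path_vec (x # y # zs) e + edge_vec a x e + edge_vec a (last (y # zs)) e"
      using bit_add_self[of "edge_vec a y e"] by (simp add: algebra_simps)
  qed
  ultimately show ?case by simp
qed simp

text \<open>A walk with at most two vertices and distinct ends is a single edge. Hence the 1-chains
  at scale 1 are all the functions on the edges of the graph.\<close>

lemma edge_in_rips:
  assumes G: "ulf_graph V E"
  shows "\<sigma> \<in> rips V E 1 \<and> card \<sigma> = 2 \<longleftrightarrow> \<sigma> \<in> E"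
proof
  assume \<sigma>: "\<sigma> \<in> rips V E 1 \<and> card \<sigma> = 2"
  then obtain u v where uv: "\<sigma> = {u, v}" "u \<noteq> v" by (auto simp: card_2_iff)
  then have "graph_dist E u v \<le> enat 1" using \<sigma> by (simp add: rips_def)
  then obtain p where p: "p \<in> walks E u v" "length p \<le> Suc 1" unfolding graph_dist_le_iff by blast
  then have "p = [u, v]" using uv
    by (cases p; cases "tl p") (auto simp: walks_def split: if_splits)
  then show "\<sigma> \<in> E" using p uv by (simp add: walks_iff_successively)
next
  assume e: "\<sigma> \<in> E"
  then have \<sigma>: "\<sigma> \<subseteq> V" "card \<sigma> = 2" using G by (auto simp: ulf_graph_def)
  then obtain u v where uv: "\<sigma> = {u, v}" "u \<noteq> v" by (auto simp: card_2_iff)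
  have "graph_dist E x y \<le> enat 1" if "x \<in> \<sigma>" "y \<in> \<sigma>" for x y
  proof (cases "x = y")
    case True
    then show ?thesis unfolding graph_dist_le_iff
      by (intro bexI[of _ "[x]"]) (auto simp: walks_iff_successively)
  next
    case False
    then have "{x, y} = \<sigma>" using that uv by auto
    then show ?thesis unfolding graph_dist_le_iff using e
      by (intro bexI[of _ "[x, y]"]) (auto simp: walks_iff_successively)
  qed
  then show "\<sigma> \<in> rips V E 1 \<and> card \<sigma> = 2" using \<sigma> uv by (auto simp: rips_def)
qed

lemma circuit_vec_chain:
  assumes G: "ulf_graph V E" and c: "circuit E c"
  shows "circuit_vec c \<in> chains (rips V E 1) 1"
  using circuit_vec_support[OF c] edge_in_rips[OF G]
  unfolding chains_def mem_Collect_eq by (metis Suc_1 One_nat_def)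

text \<open>A circuit has bounded diameter, so at a scale depending on its length the cone with apex
  \<open>hd c\<close> consists of simplices.\<close>

lemma circuit_vec_boundary:
  assumes G: "ulf_graph V E" and c: "circuit E c"
  shows "\<exists>r. circuit_vec c \<in> boundaries (rips V E r) 1"
proof -
  define p where "p = c @ [hd c]"
  \<comment> \<open>Each vertex of the walk is within \<open>length p\<close> of the apex, hence any
    two are within twice that.\<close>
  define r where "r = length p + length p"
  have ne: "c \<noteq> []" and p: "p \<in> walks E (hd c) (hd c)" using c by (auto simp: circuit_iff_walk p_def)
  have "{c ! 0, c ! (Suc 0 mod length c)} \<in> E"
    using c ne unfolding circuit_def length_greater_0_conv[symmetric] by blast
  then have hdV: "hd c \<in> V" using G ne by (auto simp: ulf_graph_def hd_conv_nth)
  have pV: "set p \<subseteq> V" by (rule walk_vertices_in_V[OF G p hdV])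
  have d: "graph_dist E (hd c) x \<le> enat (length p)" if "x \<in> set p" for x
    by (rule graph_dist_walk_vertex[OF p _ that]) simp
  have dd: "graph_dist E x y \<le> enat r" if "x \<in> set p" "y \<in> set p" for x y
    unfolding r_def
    by (rule graph_dist_le_triangle[OF graph_dist_le_commute[OF d[OF that(1)]] d[OF that(2)]])
  have sub: "{hd c, x, y} \<in> rips V E r" if "x \<in> set p" "y \<in> set p" for x y
    using that pV dd hdV by (auto simp: rips_def p_def)
  have "\<And>x y. {x, y} \<in> E \<Longrightarrow> x \<noteq> y" using G by (auto simp: ulf_graph_def)
  then have "successively (\<noteq>) p"
    using p unfolding walks_iff_successively by (blast intro: successively_mono)
  from cone_boundary[OF rips_locally_finite[OF G] sub this]
  have "(\<lambda>e. path_vec p e + edge_vec (hd c) (hd p) e + edge_vec (hd c) (last p) e)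
      \<in> boundaries (rips V E r) 1" by (simp add: p_def)
  \<comment> \<open>The walk starts and ends at the apex, so both remaining spokes are degenerate
    and vanish.\<close>
  moreover have "hd p = hd c" "last p = hd c" using ne by (auto simp: p_def)
  ultimately show ?thesis using circuit_vec_eq_path_vec[OF ne]
    by (auto simp: edge_vec_def p_def)
qed

section \<open>Boundaries in Rips complexes are sums of short circuits\<close>

text \<open>Each edge of the Rips complex is replaced by a walk in the graph, each edge of the graph by
  itself. This turns the boundary of a triangle into a circuit of length at most \<open>3 * R\<close> and fixes
  every chain supported on the edges of the graph.\<close>

lemma rips_boundary_circuit_sums:
  assumes G: "ulf_graph V E" and R: "1 \<le> R"
    and b1: "b \<in> chains (rips V E 1) 1" and bR: "b \<in> boundaries (rips V E R) 1"
  shows "b \<in> circuit_sums E (3 * R)"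
proof -
  define K where "K = rips V E R"
  have K: "locally_finite_complex K" unfolding K_def by (rule rips_locally_finite[OF G])
  obtain c where c: "c \<in> chains K 2" and b: "b = boundary K c"
    using bR by (auto simp: boundaries_def K_def numeral_2_eq_2)
  have bE: "e \<in> E" if "b e \<noteq> 0" for e
  proof -
    have "e \<in> rips V E 1 \<and> card e = 2" using b1 that by (auto simp: chains_def)
    then show ?thesis using edge_in_rips[OF G] by blast
  qed
  define S where "S = {\<sigma> \<in> K. card \<sigma> = 2}"
  have ES: "E \<subseteq> S"
    using edge_in_rips[OF G] rips_mono[OF R, of V E] by (auto simp: S_def K_def)
  \<comment> \<open>The choice is made for edge vectors and not for walks, since a vector does not
    depend on the direction in which the edge \<sigma> is traversed.\<close>
  have "\<exists>w. (\<forall>x y. \<sigma> = {x, y} \<longrightarrow> (\<exists>p\<in>walks E x y. length p \<le> Suc R \<and> path_vec p = w)) \<and>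
      (\<sigma> \<in> E \<longrightarrow> w = (\<lambda>e. of_bool (\<sigma> = e)))" if \<sigma>: "\<sigma> \<in> S" for \<sigma>
  proof -
    obtain u v where uv: "\<sigma> = {u, v}" "u \<noteq> v" using \<sigma> by (auto simp: S_def card_2_iff)
    have "\<exists>p\<in>walks E u v. length p \<le> Suc R \<and> (\<sigma> \<in> E \<longrightarrow> path_vec p = (\<lambda>e. of_bool (\<sigma> = e)))"
    proof (cases "\<sigma> \<in> E")
      case True
      then show ?thesis using uv R
        by (intro bexI[of _ "[u, v]"]) (auto simp: walks_iff_successively fun_eq_iff)
    next
      case False
      have "graph_dist E u v \<le> enat R" using \<sigma> uv by (auto simp: S_def K_def rips_def)
      then show ?thesis using False by (auto simp: graph_dist_le_iff)
    qed
    then obtain p where p: "p \<in> walks E u v" "length p \<le> Suc R"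
      "\<sigma> \<in> E \<longrightarrow> path_vec p = (\<lambda>e. of_bool (\<sigma> = e))" by blast
    have "\<exists>q\<in>walks E x y. length q \<le> Suc R \<and> path_vec q = path_vec p" if "\<sigma> = {x, y}" for x y
    proof (cases "x = u")
      case True
      then have "y = v" using that uv by auto
      then show ?thesis using True p by blast
    next
      case False
      then have "x = v" "y = u" using that uv by (auto simp: doubleton_eq_iff)
      then show ?thesis using p walk_rev[OF p(1)]
        by (intro bexI[of _ "rev p"]) (auto simp: path_vec_rev fun_eq_iff)
    qed
    then show ?thesis using p(3) by blast
  qed
  then obtain \<pi> where *: "\<forall>\<sigma>\<in>S.
      (\<forall>x y. \<sigma> = {x, y} \<longrightarrow> (\<exists>p\<in>walks E x y. length p \<le> Suc R \<and> path_vec p = \<pi> \<sigma>)) \<and>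
      (\<sigma> \<in> E \<longrightarrow> \<pi> \<sigma> = (\<lambda>e. of_bool (\<sigma> = e)))"
    by (rule bchoice[OF ballI, THEN exE]) blast+
  then have \<pi>: "\<exists>p\<in>walks E x y. length p \<le> Suc R \<and> path_vec p = \<pi> \<sigma>"
    if "\<sigma> \<in> S" "\<sigma> = {x, y}" for \<sigma> x y using that by blast
  have \<pi>E: "\<pi> \<sigma> = (\<lambda>e. of_bool (\<sigma> = e))" if "\<sigma> \<in> E" for \<sigma>
    using * that ES by blast
  \<comment> \<open>The chosen walks stay within distance \<open>R\<close> of the vertices that they
    connect. All finiteness claims below rest on this.\<close>
  have near: "e \<in> E \<and> (\<exists>u\<in>e. graph_dist E u x \<le> enat R)"
    if \<sigma>: "\<sigma> \<in> S" and e: "\<pi> \<sigma> e \<noteq> 0" and x: "x \<in> \<sigma>" for \<sigma> e x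
  proof -
    obtain y where "\<sigma> = {x, y}" using \<sigma> x by (auto simp: S_def card_2_iff)
    then obtain p where p: "p \<in> walks E x y" "length p \<le> Suc R" "path_vec p = \<pi> \<sigma>"
      using \<pi>[OF \<sigma>] by blast
    then obtain i where i: "Suc i < length p" "e = {p ! i, p ! Suc i}"
      using path_vec_support[of p e] e by auto
    then have "graph_dist E x (p ! i) \<le> enat R" by (intro graph_dist_walk_vertex[OF p(1,2)]) simp
    then show ?thesis using i p(1) graph_dist_le_commute by (auto simp: walks_def)
  qed
  \<comment> \<open>Rips edges whose replacing walk passes through \<open>e\<close> an odd number of
    times.\<close>
  define Se where "Se e = {\<sigma> \<in> S. \<pi> \<sigma> e \<noteq> 0}" for e
  have SeE: "e \<in> E" if "\<sigma> \<in> Se e" for \<sigma> e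
  proof -
    have "\<sigma> \<in> S" "\<pi> \<sigma> e \<noteq> 0" using that by (auto simp: Se_def)
    moreover obtain x where "x \<in> \<sigma>" using \<open>\<sigma> \<in> S\<close> by (fastforce simp: S_def)
    ultimately show ?thesis using near by blast
  qed
  have finSe: "finite (Se e)" for e
  proof (cases "e \<in> E")
    case True
    then have e: "e \<subseteq> V" "card e = 2" using G by (auto simp: ulf_graph_def)
    then have "finite e" by (intro card_ge_0_finite) simp
    then have "finite (\<Union>u\<in>e. {x. graph_dist E u x \<le> enat R})"
      using e finite_ball[OF G] by blast
    moreover have "Se e \<subseteq> Pow (\<Union>u\<in>e. {x. graph_dist E u x \<le> enat R})"
      unfolding Se_def using near by fastforce
    ultimately show ?thesis by (meson finite_Pow_iff finite_subset)
  next
    case False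
    then have "Se e = {}" using SeE by blast
    then show ?thesis by simp
  qed
  define Te where "Te e = {\<tau> \<in> K. card \<tau> = 3 \<and> (\<exists>\<sigma>\<in>Se e. \<sigma> \<subset> \<tau>)}" for e
  have finTe: "finite (Te e)" for e
  proof -
    have "Te e \<subseteq> (\<Union>\<sigma>\<in>Se e. {\<tau>. \<tau> \<in> K \<and> \<sigma> \<subset> \<tau> \<and> True})" by (auto simp: Te_def)
    moreover have "finite (\<Union>\<sigma>\<in>Se e. {\<tau>. \<tau> \<in> K \<and> \<sigma> \<subset> \<tau> \<and> True})"
      by (intro finite_UN_I finSe finite_cofaces[OF K]) (simp add: Se_def S_def)
    ultimately show ?thesis by (rule finite_subset)
  qed
  \<comment> \<open>The boundary of the triangle \<tau> after each side is replaced by its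
    walk.\<close>
  define f where "f \<tau> e = (\<Sum>\<sigma> | \<sigma> \<subset> \<tau> \<and> card \<sigma> = 2. \<pi> \<sigma> e)" for \<tau> e
  define I where "I = {\<tau>. c \<tau> \<noteq> 0}"
  have IK: "\<tau> \<in> K" "card \<tau> = 3" if "\<tau> \<in> I" for \<tau>
    using c that by (auto simp: chains_def I_def)
  have face: "\<sigma> \<in> S" if "\<tau> \<in> K" "\<sigma> \<subset> \<tau>" "card \<sigma> = 2" for \<sigma> \<tau>
    using face_closed[OF K that(1), of \<sigma>] that by (force simp: S_def)
  have circ: "f \<tau> \<in> circuit_vec ` {c. circuit E c \<and> length c \<le> 3 * R}"
    if \<tau>: "\<tau> \<in> K" "card \<tau> = 3" for \<tau>
  proof -
    obtain x y z where xyz: "\<tau> = {x, y, z}" "x \<noteq> y" "y \<noteq> z" "x \<noteq> z"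
      using \<tau>(2) by (auto simp: card_3_iff)
    note sub = two_subsets_of_triple[OF xyz(2,3,4)]
    have S3: "{x, y} \<in> S" "{y, z} \<in> S" "{x, z} \<in> S"
      by (rule face[OF \<tau>(1)]; use sub[THEN iffD2] xyz in simp)+
    obtain p where p: "p \<in> walks E x y" "length p \<le> Suc R" "path_vec p = \<pi> {x, y}"
      using \<pi>[OF S3(1) refl] by blast
    obtain q where q: "q \<in> walks E y z" "length q \<le> Suc R" "path_vec q = \<pi> {y, z}"
      using \<pi>[OF S3(2) refl] by blast
    obtain r where r: "r \<in> walks E z x" "length r \<le> Suc R" "path_vec r = \<pi> {x, z}"
      using \<pi>[OF S3(3) insert_commute] by blast
    define w where "w = (p @ tl q) @ tl r"
    have pq: "p @ tl q \<in> walks E x z" by (rule walk_append[OF p(1) q(1)])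
    have w: "w \<in> walks E x x" unfolding w_def by (rule walk_append[OF pq r(1)])
    have vec: "path_vec w e = \<pi> {x, y} e + \<pi> {y, z} e + \<pi> {x, z} e" for e
    proof -
      have "path_vec w e = path_vec (p @ tl q) e + path_vec r e"
        unfolding w_def by (rule path_vec_append) (use pq r(1) in \<open>simp_all add: walks_def\<close>)
      also have "path_vec (p @ tl q) e = path_vec p e + path_vec q e"
        by (rule path_vec_append) (use p(1) q(1) in \<open>simp_all add: walks_def\<close>)
      finally show ?thesis by (simp add: p q r)
    qed
    have "{\<sigma>. \<sigma> \<subset> \<tau> \<and> card \<sigma> = 2} = {{x, y}, {y, z}, {x, z}}"
      unfolding xyz(1) sub by blast
    moreover have "{x, y} \<noteq> {y, z}" "{x, y} \<noteq> {x, z}" "{y, z} \<noteq> {x, z}"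
      using xyz by (auto simp: doubleton_eq_iff)
    ultimately have "f \<tau> = path_vec w" by (auto simp: f_def vec fun_eq_iff add.assoc)
    moreover have "2 \<le> length p" using p(1) xyz(2)
      by (cases p rule: list.exhaust; cases "tl p") (auto simp: walks_def)
    then have "2 \<le> length w" by (simp add: w_def)
    \<comment> \<open>The three walks have at most \<open>3 * Suc R\<close> vertices together; two
      joints and the repeated starting vertex are dropped.\<close>
    moreover have "length (butlast w) \<le> 3 * R"
      using p q r by (auto simp: w_def walks_def)
    ultimately show ?thesis using closed_walk_circuit[OF w]
      by (intro image_eqI[of _ _ "butlast w"]) auto
  qed
  have fTe: "f \<tau> e = (\<Sum>\<sigma> | \<sigma> \<in> Se e \<and> \<sigma> \<subset> \<tau>. \<pi> \<sigma> e)" if "\<tau> \<in> K" for \<tau> e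
    unfolding f_def
  proof (rule sum.mono_neutral_right)
    have "finite \<tau>" using K that by (auto simp: locally_finite_complex_def)
    then show "finite {\<sigma>. \<sigma> \<subset> \<tau> \<and> card \<sigma> = 2}"
      by (auto intro: finite_subset[of _ "Pow \<tau>"])
    show "{\<sigma>. \<sigma> \<in> Se e \<and> \<sigma> \<subset> \<tau>} \<subseteq> {\<sigma>. \<sigma> \<subset> \<tau> \<and> card \<sigma> = 2}" by (auto simp: Se_def S_def)
    show "\<forall>\<sigma>\<in>{\<sigma>. \<sigma> \<subset> \<tau> \<and> card \<sigma> = 2} - {\<sigma>. \<sigma> \<in> Se e \<and> \<sigma> \<subset> \<tau>}. \<pi> \<sigma> e = 0"
      using face[OF that] by (auto simp: Se_def)
  qed
  have ITe: "{\<tau> \<in> I. f \<tau> e \<noteq> 0} \<subseteq> Te e" for e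
  proof
    fix \<tau> assume "\<tau> \<in> {\<tau> \<in> I. f \<tau> e \<noteq> 0}"
    then have \<tau>: "\<tau> \<in> K" "card \<tau> = 3" "f \<tau> e \<noteq> 0" using IK by auto
    then have "(\<Sum>\<sigma> | \<sigma> \<in> Se e \<and> \<sigma> \<subset> \<tau>. \<pi> \<sigma> e) \<noteq> 0" using fTe by simp
    then have "{\<sigma>. \<sigma> \<in> Se e \<and> \<sigma> \<subset> \<tau>} \<noteq> {}" by (metis sum.empty)
    then show "\<tau> \<in> Te e" using \<tau> by (auto simp: Te_def)
  qed
  have "thin E I f"
    unfolding thin_def using ITe finTe by (blast intro: finite_subset)
  moreover have "f ` I \<subseteq> circuit_vec ` {c. circuit E c \<and> length c \<le> 3 * R}"
    using circ IK by blast
  moreover have "e \<in> E" if "\<tau> \<in> I" "f \<tau> e \<noteq> 0" for \<tau> e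
    using ITe[of e] that SeE by (auto simp: Te_def)
  ultimately have "thin_sum I f \<in> circuit_sums E (3 * R)"
    unfolding circuit_sums_def by (rule thin_sums_arbitrary_index)
  moreover have "thin_sum I f = b"
  proof
    fix e
    \<comment> \<open>The coefficient \<open>c \<tau>\<close> is 1 on \<open>I\<close> and 0
      elsewhere, so the sum may be extended to the finite set \<open>Te e\<close>.\<close>
    have "thin_sum I f e = (\<Sum>\<tau>\<in>{\<tau> \<in> I. f \<tau> e \<noteq> 0}. c \<tau> * f \<tau> e)"
      unfolding thin_sum_def by (intro sum.cong) (auto simp: I_def)
    also have "\<dots> = (\<Sum>\<tau>\<in>Te e. c \<tau> * f \<tau> e)"
      by (rule sum.mono_neutral_left[OF finTe ITe]) (auto simp: I_def)
    also have "\<dots> = (\<Sum>\<tau>\<in>Te e. \<Sum>\<sigma> | \<sigma> \<in> Se e \<and> \<sigma> \<subset> \<tau>. c \<tau> * \<pi> \<sigma> e)"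
      by (intro sum.cong refl) (simp add: fTe Te_def sum_distrib_left)
    \<comment> \<open>After the exchange, the inner sum runs over all triangles containing \<sigma>
      and gives the boundary coefficient \<open>b \<sigma>\<close>.\<close>
    also have "\<dots> = (\<Sum>\<sigma>\<in>Se e. \<Sum>\<tau> | \<tau> \<in> Te e \<and> \<sigma> \<subset> \<tau>. c \<tau> * \<pi> \<sigma> e)"
      by (rule sum.swap_restrict[OF finTe finSe])
    also have "\<dots> = (\<Sum>\<sigma>\<in>Se e. b \<sigma> * \<pi> \<sigma> e)"
    proof (rule sum.cong[OF refl])
      fix \<sigma> assume \<sigma>: "\<sigma> \<in> Se e"
      then have "{\<tau>. \<tau> \<in> Te e \<and> \<sigma> \<subset> \<tau>} = {\<tau>. \<tau> \<in> K \<and> \<sigma> \<subset> \<tau> \<and> card \<tau> = Suc (card \<sigma>)}"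
        by (auto simp: Te_def Se_def S_def)
      moreover have "\<sigma> \<in> K" using \<sigma> by (simp add: Se_def S_def)
      ultimately show "(\<Sum>\<tau> | \<tau> \<in> Te e \<and> \<sigma> \<subset> \<tau>. c \<tau> * \<pi> \<sigma> e) = b \<sigma> * \<pi> \<sigma> e"
        by (simp add: b boundary_def sum_distrib_right)
    qed
    \<comment> \<open>Since \<open>b\<close> is supported on graph edges, which are replaced by
      themselves, only \<sigma> = \<open>e\<close> can contribute.\<close>
    also have "\<dots> = (\<Sum>\<sigma>\<in>Se e. if \<sigma> = e then b e else 0)"
    proof (rule sum.cong[OF refl])
      fix \<sigma>
      show "b \<sigma> * \<pi> \<sigma> e = (if \<sigma> = e then b e else 0)"
      proof (cases "\<sigma> \<in> E")
        case True
        then show ?thesis by (simp add: \<pi>E)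
      next
        case False
        then have "b \<sigma> = 0" using bE by blast
        then show ?thesis by auto
      qed
    qed
    also have "\<dots> = b e"
    proof (cases "e \<in> E")
      case True
      then have "e \<in> Se e" using ES \<pi>E by (auto simp: Se_def)
      then show ?thesis using finSe by simp
    next
      case False
      then have "b e = 0" using bE by blast
      then show ?thesis by simp
    qed
    finally show "thin_sum I f e = b e" .
  qed
  ultimately show ?thesis by simp
qed

section \<open>Increasing closed subgroups of finite index in a compact group\<close>

lemma finite_UNIV_bit: "finite (UNIV :: bit set)"
proof (rule finite_subset)
  show "(UNIV :: bit set) \<subseteq> {0, 1}" by (auto simp: bit_not_zero_iff)
qed simp

text \<open>The topology of pointwise convergence; compactness comes from Tychonoff, as
  \<open>bit\<close> is finite and discrete.\<close>

definition cochain_topology :: "('a \<Rightarrow> bit) topology" where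
  "cochain_topology = product_topology (\<lambda>_. discrete_topology UNIV) UNIV"

lemma topspace_cochain_topology [simp]: "topspace cochain_topology = UNIV"
  by (simp add: cochain_topology_def PiE_UNIV_domain)

lemma compact_space_cochain_topology: "compact_space cochain_topology"
  by (simp add: cochain_topology_def compact_space_product_topology
      compact_space_discrete_topology finite_UNIV_bit)

lemma Hausdorff_space_cochain_topology: "Hausdorff_space cochain_topology"
  by (simp add: cochain_topology_def Hausdorff_space_product_topology)

lemma openin_cylinder:
  assumes "finite F"
  shows "openin cochain_topology {y. \<forall>i\<in>F. y i = x i}"
proof -
  let ?X = "\<lambda>i. {v. i \<in> F \<longrightarrow> v = x i}"
  have "finite {i. ?X i \<noteq> topspace (discrete_topology UNIV)}"
    by (rule finite_subset[OF _ assms]) auto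
  then have "openin cochain_topology (\<Pi>\<^sub>E i\<in>UNIV. ?X i)"
    unfolding cochain_topology_def by (intro product_topology_basis) auto
  moreover have "(\<Pi>\<^sub>E i\<in>UNIV. ?X i) = {y. \<forall>i\<in>F. y i = x i}"
    by (auto simp: PiE_UNIV_domain Pi_iff)
  ultimately show ?thesis by simp
qed

lemma openin_contains_cylinder:
  assumes "openin cochain_topology U" "x \<in> U"
  obtains F where "finite F" "\<And>y. \<forall>i\<in>F. y i = x i \<Longrightarrow> y \<in> U"
proof -
  obtain X where X: "x \<in> (\<Pi>\<^sub>E i\<in>UNIV. X i)"
      "finite {i. X i \<noteq> topspace (discrete_topology UNIV)}" "(\<Pi>\<^sub>E i\<in>UNIV. X i) \<subseteq> U"
    using product_topology_open_contains_basis[OF assms[unfolded cochain_topology_def]] by blast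
  have "y \<in> U" if y: "\<forall>i\<in>{i. X i \<noteq> UNIV}. y i = x i" for y
  proof -
    have "y i \<in> X i" for i
      using X(1) y by (cases "X i = UNIV") (auto simp: PiE_UNIV_domain)
    then show ?thesis using X(3) by (auto simp: PiE_UNIV_domain)
  qed
  then show thesis using X(2) by (intro that[of "{i. X i \<noteq> UNIV}"]) auto
qed

text \<open>The cylinder over \<open>F\<close> through a point outside \<open>C\<close> is an open
  neighbourhood that misses \<open>C\<close>.\<close>

lemma closedin_if_finitely_refutable:
  assumes "\<And>x. x \<notin> C \<Longrightarrow> \<exists>F. finite F \<and> (\<forall>y. (\<forall>i\<in>F. y i = x i) \<longrightarrow> y \<notin> C)"
  shows "closedin cochain_topology C"
proof -
  have "openin cochain_topology (- C)"
  proof (subst openin_subopen, intro ballI)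
    fix x assume "x \<in> - C"
    then obtain F where "finite F" "\<forall>y. (\<forall>i\<in>F. y i = x i) \<longrightarrow> y \<notin> C" using assms by blast
    then show "\<exists>T. openin cochain_topology T \<and> x \<in> T \<and> T \<subseteq> - C"
      using openin_cylinder[of F x] by (intro exI[of _ "{y. \<forall>i\<in>F. y i = x i}"]) auto
  qed
  then show ?thesis by (simp add: closedin_def Compl_eq_Diff_UNIV)
qed

text \<open>Each coordinate of \<open>g\<close> is constant on cylinders over its own finite set,
  hence locally constant; continuity into a product is checked by coordinates.\<close>

lemma continuous_map_finite_dependence:
  assumes "\<And>k. \<exists>F. finite F \<and> (\<forall>x y. (\<forall>i\<in>F. y i = x i) \<longrightarrow> g y k = g x k)"
  shows "continuous_map cochain_topology cochain_topology g"
proof -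
  have "continuous_map cochain_topology (discrete_topology UNIV) (\<lambda>x. g x k)" for k
  proof -
    obtain F where F: "finite F" "\<And>x y. \<forall>i\<in>F. y i = x i \<Longrightarrow> g y k = g x k" using assms by blast
    have "openin cochain_topology {x. g x k \<in> U}" for U
    proof (subst openin_subopen, intro ballI)
      fix x assume x: "x \<in> {x. g x k \<in> U}"
      have "{y. \<forall>i\<in>F. y i = x i} \<subseteq> {x. g x k \<in> U}"
      proof (intro subsetI CollectI)
        fix y assume "y \<in> {y. \<forall>i\<in>F. y i = x i}"
        then have "g y k = g x k" by (intro F(2)) blast
        then show "g y k \<in> U" using x by simp
      qed
      then show "\<exists>T. openin cochain_topology T \<and> x \<in> T \<and> T \<subseteq> {x. g x k \<in> U}"
        using openin_cylinder[OF F(1), of x] by blast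
    qed
    then show ?thesis by (simp add: continuous_map_def)
  qed
  then show ?thesis
    unfolding cochain_topology_def continuous_map_componentwise_UNIV by blast
qed

text \<open>By Baire some coset of some \<open>B r\<close> has interior in \<open>G\<close>, hence \<open>B r\<close> contains all
  elements of \<open>G\<close> vanishing on some finite set \<open>F\<close>; modulo those only finitely many elements of
  the union of the \<open>B s\<close> remain.\<close>

lemma closed_subgroups_stabilize:
  fixes G :: "('a \<Rightarrow> bit) set" and B :: "nat \<Rightarrow> ('a \<Rightarrow> bit) set"
  assumes G: "closedin cochain_topology G" "(\<lambda>_. 0) \<in> G"
      "\<And>x y. x \<in> G \<Longrightarrow> y \<in> G \<Longrightarrow> (\<lambda>i. x i + y i) \<in> G"
    and B: "\<And>r. closedin cochain_topology (B r)"
      "\<And>r x y. x \<in> B r \<Longrightarrow> y \<in> B r \<Longrightarrow> (\<lambda>i. x i + y i) \<in> B r"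
    and mono: "\<And>r s. r \<le> s \<Longrightarrow> B r \<subseteq> B s"
    and A: "finite A" "\<And>x. x \<in> G \<Longrightarrow> \<exists>a\<in>A. \<exists>r. (\<lambda>i. x i + a i) \<in> B r"
  shows "\<exists>R. \<forall>r. G \<inter> B r \<subseteq> B R"
proof -
  let ?X = "subtopology cochain_topology G"
  define T where "T a r = {x \<in> G. (\<lambda>i. x i + a i) \<in> B r}" for a r
  have X: "compact_space ?X" "Hausdorff_space ?X"
    using closedin_compact_space[OF compact_space_cochain_topology G(1)]
    by (auto intro: compact_space_subtopology Hausdorff_space_subtopology
        Hausdorff_space_cochain_topology)
  have closed: "closedin ?X (T a r)" for a r
  proof -
    have "continuous_map cochain_topology cochain_topology (\<lambda>x i. x i + a i)"
      by (rule continuous_map_finite_dependence) (metis finite.emptyI finite.insertI insertI1)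
    from closedin_continuous_map_preimage[OF this B(1)]
    have "closedin cochain_topology {x. (\<lambda>i. x i + a i) \<in> B r}" by simp
    from closedin_subtopology_Int_closed[OF this, of G] show ?thesis
      by (simp add: T_def Collect_conj_eq)
  qed
  \<comment> \<open>The countably many closed sets \<open>T a r\<close> cover the nonempty compact
    Hausdorff space \<open>G\<close>, so by Baire they cannot all have empty interior.\<close>
  have "\<exists>a\<in>A. \<exists>r. ?X interior_of T a r \<noteq> {}"
  proof (rule ccontr)
    assume empty: "\<not> (\<exists>a\<in>A. \<exists>r. ?X interior_of T a r \<noteq> {})"
    let ?G = "(\<lambda>(a, r). T a r) ` (A \<times> UNIV)"
    have "?X interior_of \<Union>?G = {}"
    proof (rule Baire_category_alt)
      show "completely_metrizable_space ?X \<or> locally_compact_space ?X \<and> regular_space ?X"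
        using X by (simp add: compact_imp_locally_compact_space compact_Hausdorff_imp_regular_space)
      show "countable ?G"
        using A(1) by (intro countable_image countable_SIGMA) (auto intro: countable_finite)
      show "closedin ?X S \<and> ?X interior_of S = {}" if "S \<in> ?G" for S
        using that empty closed by auto
    qed
    moreover have "\<Union>?G = topspace ?X"
      using A(2) by (fastforce simp: T_def)
    ultimately have "G = {}"
      by (metis interior_of_topspace topspace_subtopology topspace_cochain_topology Int_UNIV_left)
    then show False using G(2) by blast
  qed
  then obtain a r x where x: "x \<in> ?X interior_of T a r" by blast
  then obtain U where U: "openin ?X U" "x \<in> U" "U \<subseteq> T a r" by (auto simp: interior_of_def)
  then obtain W where W: "openin cochain_topology W" "U = W \<inter> G" by (auto simp: openin_subtopology)
  then obtain F where F: "finite F" "\<And>y. \<forall>i\<in>F. y i = x i \<Longrightarrow> y \<in> W"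
    using openin_contains_cylinder[of W x] U by blast
  have xT: "x \<in> T a r" using U by blast
  \<comment> \<open>Adding \<open>z\<close> to \<open>x\<close> changes nothing on \<open>F\<close>,
    so the result stays in \<open>T a r\<close>. In the sum of the two shifted elements
    \<open>x\<close> and \<open>a\<close> cancel, which leaves \<open>z\<close> in
    \<open>B r\<close>.\<close>
  have vanish: "z \<in> B r" if z: "z \<in> G" "\<forall>i\<in>F. z i = 0" for z
  proof -
    let ?y = "\<lambda>i. x i + z i"
    have "?y \<in> G" using G(3) xT z by (simp add: T_def)
    moreover have "?y \<in> W" using F(2)[of ?y] z by simp
    ultimately have "?y \<in> T a r" using U W by blast
    then have "(\<lambda>i. ?y i + a i) \<in> B r" "(\<lambda>i. x i + a i) \<in> B r" using xT by (auto simp: T_def)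
    then have "(\<lambda>i. (?y i + a i) + (x i + a i)) \<in> B r" by (rule B(2))
    moreover have "(?y i + a i) + (x i + a i) = z i" for i
      using bit_add_self[of "x i"] bit_add_self[of "a i"] by (simp add: algebra_simps)
    ultimately show ?thesis by simp
  qed
  \<comment> \<open>Only finitely many restrictions to \<open>F\<close> occur on \<open>N\<close>,
    and two elements with the same restriction differ by an element of \<open>B r\<close>.\<close>
  define N where "N = G \<inter> (\<Union>s. B s)"
  let ?res = "\<lambda>b. restrict b F"
  have "finite (?res ` N)"
  proof (rule finite_subset)
    show "?res ` N \<subseteq> F \<rightarrow>\<^sub>E UNIV" by auto
    show "finite (F \<rightarrow>\<^sub>E (UNIV :: bit set))" using F(1) by (intro finite_PiE finite_UNIV_bit)
  qed
  then obtain M where M: "finite M" "M \<subseteq> N" "?res ` N = ?res ` M"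
    by (metis finite_subset_image order_refl)
  have "\<exists>s. b \<in> B s" if "b \<in> M" for b using that M(2) by (auto simp: N_def)
  then obtain s where s: "\<And>b. b \<in> M \<Longrightarrow> b \<in> B (s b)" by metis
  \<comment> \<open>A scale that absorbs both \<open>B r\<close> and the finitely many
    representatives in \<open>M\<close>.\<close>
  define R where "R = Max (insert r (s ` M))"
  have R: "r \<le> R" "\<And>b. b \<in> M \<Longrightarrow> s b \<le> R" using M(1) by (auto simp: R_def)
  have "b \<in> B R" if b: "b \<in> G" "b \<in> B q" for b q
  proof -
    have "b \<in> N" using b by (auto simp: N_def)
    then obtain m where m: "m \<in> M" "?res b = ?res m" using M(3) by (metis imageE imageI)
    have "b i + m i = 0" if "i \<in> F" for i
      using fun_cong[OF m(2), of i] that by simp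
    moreover have "m \<in> G" using m M(2) by (auto simp: N_def)
    ultimately have "(\<lambda>i. b i + m i) \<in> B r" using b by (intro vanish G(3)) auto
    then have "(\<lambda>i. b i + m i) \<in> B R" "m \<in> B R" using mono R s[OF m(1)] m(1) by blast+
    then have "(\<lambda>i. (b i + m i) + m i) \<in> B R" by (rule B(2))
    then show ?thesis by (simp add: add.assoc)
  qed
  then show ?thesis by blast
qed

section \<open>Finite dimension of the uniformly finite homology\<close>

lemma continuous_map_boundary:
  assumes K: "locally_finite_complex K"
  shows "continuous_map cochain_topology cochain_topology (boundary K)"
proof (rule continuous_map_finite_dependence)
  fix \<sigma>
  show "\<exists>F. finite F \<and> (\<forall>x y. (\<forall>i\<in>F. y i = x i) \<longrightarrow> boundary K y \<sigma> = boundary K x \<sigma>)"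
  proof (cases "\<sigma> \<in> K")
    case True
    then show ?thesis
      using finite_cofaces[OF K True, of "\<lambda>\<tau>. card \<tau> = Suc (card \<sigma>)"]
      by (intro exI[of _ "{\<tau>. \<tau> \<in> K \<and> \<sigma> \<subset> \<tau> \<and> card \<tau> = Suc (card \<sigma>)}"])
        (auto simp: boundary_def intro!: sum.cong)
  next
    case False
    then show ?thesis by (intro exI[of _ "{}"]) (simp add: boundary_def)
  qed
qed

lemma closedin_chains: "closedin cochain_topology (chains K n)"
proof (rule closedin_if_finitely_refutable)
  fix x assume "x \<notin> chains K n"
  then obtain \<sigma> where "x \<sigma> \<noteq> 0" "\<not> (\<sigma> \<in> K \<and> card \<sigma> = Suc n)" unfolding chains_def by blast
  then show "\<exists>F. finite F \<and> (\<forall>y. (\<forall>i\<in>F. y i = x i) \<longrightarrow> y \<notin> chains K n)"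
    by (intro exI[of _ "{\<sigma>}"]) (auto simp: chains_def)
qed

lemma closedin_cycles:
  assumes K: "locally_finite_complex K"
  shows "closedin cochain_topology (cycles K n)"
proof -
  have "closedin cochain_topology {\<lambda>_. 0}"
    by (rule compactin_imp_closedin[OF Hausdorff_space_cochain_topology]) simp
  from closedin_continuous_map_preimage_gen[OF continuous_map_boundary[OF K] closedin_chains this]
  show ?thesis by (simp add: cycles_def)
qed

text \<open>Chains of arbitrary support form a compact group, and its continuous image in a
  Hausdorff space is closed.\<close>

lemma closedin_boundaries:
  assumes K: "locally_finite_complex K"
  shows "closedin cochain_topology (boundaries K n)"
  unfolding boundaries_def
  by (rule compactin_imp_closedin[OF Hausdorff_space_cochain_topology
      image_compactin[OF closedin_compact_space[OF compact_space_cochain_topology closedin_chains]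
        continuous_map_boundary[OF K]]])

section \<open>Passage from finite dimension to finitely many homology classes\<close>

lemma (in vectorspace) fin_dim_finite_carrier:
  assumes "fin_dim" "finite (carrier K)"
  shows "finite (carrier V)"
proof -
  obtain A where A: "finite A" "A \<subseteq> carrier V" "gen_set A" using assms(1) by (auto simp: fin_dim_def)
  have "carrier V \<subseteq> (\<lambda>a. lincomb a A) ` (A \<rightarrow>\<^sub>E carrier K)"
  proof
    fix v assume "v \<in> carrier V"
    then have "v \<in> span A" using A(3) by simp
    then obtain a where a: "v = lincomb a A" "a \<in> A \<rightarrow> carrier K"
      unfolding finite_span[OF A(1,2)] by blast
    \<comment> \<open>Restriction makes the coefficient function extensional, and only finitely many
      such functions exist.\<close>
    have "lincomb a A = lincomb (restrict a A) A"
      by (rule lincomb_cong) (use a A in auto)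
    then show "v \<in> (\<lambda>a. lincomb a A) ` (A \<rightarrow>\<^sub>E carrier K)" using a by auto
  qed
  moreover have "finite (A \<rightarrow>\<^sub>E carrier K)" using A(1) assms(2) by (intro finite_PiE) auto
  ultimately show ?thesis by (meson finite_imageI finite_subset)
qed

text \<open>Representatives of equal elements of a direct limit become equal at some later scale;
  modulo 2 the difference of two cycles is their sum.\<close>

lemma H_uf_class_eqD:
  assumes G: "ulf_graph V E" and z: "z \<in> cycles (rips V E r) n" and w: "w \<in> cycles (rips V E r) n"
    and eq: "dlim_class (\<lambda>r. H_suf (rips V E r) n) (\<lambda>r s. H_suf_map (rips V E s) n) r
        (hcls (rips V E r) n z)
      = dlim_class (\<lambda>r. H_suf (rips V E r) n) (\<lambda>r s. H_suf_map (rips V E s) n) r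
        (hcls (rips V E r) n w)"
  shows "\<exists>t. (\<lambda>\<sigma>. z \<sigma> + w \<sigma>) \<in> boundaries (rips V E t) n"
proof -
  note lf = rips_locally_finite[OF G]
  interpret direct_system "class_ring :: bit ring" "\<lambda>r. H_suf (rips V E r) n"
      "\<lambda>r s. H_suf_map (rips V E s) n"
    by (rule H_suf_direct_system) (simp_all add: lf rips_mono)
  have "hcls (rips V E r) n w \<in> carrier (H_suf (rips V E r) n)" using w by (simp add: carrier_H_suf)
  from cl_self[OF this] obtain t where t: "r \<le> t"
    "H_suf_map (rips V E t) n (hcls (rips V E r) n z) = H_suf_map (rips V E t) n (hcls (rips V E r) n w)"
    unfolding eq[symmetric] by (auto simp: dlim_class_def)
  note map = H_suf_map_hcls[OF lf lf rips_mono[OF t(1)]]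
  have "hcls (rips V E t) n z = hcls (rips V E t) n w" using t(2) map[OF z] map[OF w] by simp
  then have "z \<in> hcls (rips V E t) n w" using hcls_self[OF lf] by metis
  then obtain b where b: "b \<in> boundaries (rips V E t) n" "z = (\<lambda>\<sigma>. b \<sigma> + w \<sigma>)"
    by (auto simp: hcls_mem)
  then have "(\<lambda>\<sigma>. z \<sigma> + w \<sigma>) = b" by (simp add: fun_eq_iff add.assoc)
  then show ?thesis using b(1) by auto
qed

lemma finite_representatives:
  assumes "finite (f ` S)"
  obtains A where "finite A" "A \<subseteq> S" "\<And>x. x \<in> S \<Longrightarrow> \<exists>a\<in>A. f x = f a"
proof -
  obtain A where "A \<subseteq> S" "finite A" "f ` S = f ` A"
    using finite_subset_image[OF assms order_refl] by blast
  then show thesis by (intro that[of A]) (blast+)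
qed

theorem theorem4p8:
  fixes V :: "'v set" and E :: "'v set set"
  assumes "ulf_graph V E"
    and "large_circuits E"
  shows "\<not> vectorspace.fin_dim (class_ring :: bit ring) (H_uf V E 1)"
proof
  assume fd: "vectorspace.fin_dim (class_ring :: bit ring) (H_uf V E 1)"
  note G = assms(1)
  note lf = rips_locally_finite[OF G]
  interpret vectorspace "class_ring :: bit ring" "H_uf V E 1" by (rule H_uf_vectorspace[OF G])
  interpret direct_system "class_ring :: bit ring" "\<lambda>r. H_suf (rips V E r) 1"
      "\<lambda>r s. H_suf_map (rips V E s) 1"
    by (rule H_suf_direct_system) (simp_all add: lf rips_mono)
  \<comment> \<open>At scale 1 the cycles are those of the graph itself; this single group is
    compared with the boundaries of every scale.\<close>
  define Z where "Z = cycles (rips V E 1) 1"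
  define B where "B r = boundaries (rips V E r) 1" for r
  define cls where "cls z = dlim_class (\<lambda>r. H_suf (rips V E r) 1) (\<lambda>r s. H_suf_map (rips V E s) 1) 1
        (hcls (rips V E 1) 1 z)" for z
  \<comment> \<open>Finite dimension over a two-element field means finitely many elements, so the
    graph cycles fall into finitely many classes.\<close>
  have "finite (carrier (H_uf V E 1))"
    by (rule fin_dim_finite_carrier[OF fd]) (simp add: finite_UNIV_bit)
  moreover have "cls ` Z \<subseteq> carrier (H_uf V E 1)"
    unfolding H_uf_def cls_def Z_def
    by (intro image_subsetI cl_carrier) (simp add: carrier_H_suf)
  ultimately have "finite (cls ` Z)" by (rule rev_finite_subset)
  then obtain A where A: "finite A" "A \<subseteq> Z" "\<And>z. z \<in> Z \<Longrightarrow> \<exists>a\<in>A. cls z = cls a"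
    by (rule finite_representatives) blast
  have rep: "\<exists>a\<in>A. \<exists>r. (\<lambda>\<sigma>. z \<sigma> + a \<sigma>) \<in> B r" if z: "z \<in> Z" for z
  proof -
    obtain a where a: "a \<in> A" "cls z = cls a" using A(3)[OF z] by blast
    then have "\<exists>r. (\<lambda>\<sigma>. z \<sigma> + a \<sigma>) \<in> B r"
      unfolding B_def using z A(2)
      by (intro H_uf_class_eqD[OF G, where r = 1]) (auto simp: Z_def cls_def)
    then show ?thesis using a by blast
  qed
  have "\<exists>R. \<forall>r. Z \<inter> B r \<subseteq> B R"
  proof (rule closed_subgroups_stabilize[OF _ _ _ _ _ _ A(1) rep])
    show "closedin cochain_topology Z" unfolding Z_def by (rule closedin_cycles[OF lf])
    show "closedin cochain_topology (B r)" for r unfolding B_def by (rule closedin_boundaries[OF lf])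
    show "(\<lambda>_. 0) \<in> Z" unfolding Z_def cycles_def chains_def boundary_def by auto
    show "(\<lambda>i. x i + y i) \<in> Z" if "x \<in> Z" "y \<in> Z" for x y
      using that by (simp add: Z_def cycles_def chains_add boundary_add[OF lf])
    show "(\<lambda>i. x i + y i) \<in> B r" if "x \<in> B r" "y \<in> B r" for x y r
      using that unfolding B_def by (rule boundaries_add[OF lf])
    show "B r \<subseteq> B s" if "r \<le> s" for r s
      unfolding B_def by (rule boundaries_mono[OF lf lf rips_mono[OF that]])
  qed
  then obtain R where R: "\<And>r. Z \<inter> B r \<subseteq> B R" by blast
  \<comment> \<open>\<open>Suc R\<close> in place of \<open>R\<close> ensures a scale of at least 1,
    at which every graph edge is a simplex.\<close>
  have "circuit_vec c \<in> circuit_sums E (3 * Suc R)" if c: "circuit E c" for c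
  proof (rule rips_boundary_circuit_sums[OF G])
    show ch: "circuit_vec c \<in> chains (rips V E 1) 1" by (rule circuit_vec_chain[OF G c])
    obtain r where r: "circuit_vec c \<in> boundaries (rips V E r) 1"
      using circuit_vec_boundary[OF G c] by blast
    \<comment> \<open>At scale \<open>Suc r\<close> the scale-1 complex is a subcomplex, so the
      vanishing of the boundary can be carried back to scale 1.\<close>
    then have r': "circuit_vec c \<in> boundaries (rips V E (Suc r)) 1"
      using boundaries_mono[OF lf lf rips_mono[of r "Suc r"]] by auto
    then have "boundary (rips V E (Suc r)) (circuit_vec c) = (\<lambda>_. 0)"
      by (auto simp: boundaries_def boundary_boundary[OF lf])
    then have "circuit_vec c \<in> Z"
      unfolding Z_def cycles_def
      using ch boundary_subcomplex[OF lf lf rips_mono[of 1 "Suc r"] ch] by simp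
    then have "circuit_vec c \<in> B R" using R r unfolding B_def by blast
    then show "circuit_vec c \<in> boundaries (rips V E (Suc R)) 1"
      unfolding B_def using boundaries_mono[OF lf lf rips_mono[of R "Suc R"]] by auto
  qed simp
  then show False using assms(2) unfolding large_circuits_def
    by (metis mult_pos_pos zero_less_Suc zero_less_numeral)
qed

end
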